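(* Let $\mathcal W=((W_i,c_i))_{i\in I}$ be a fusion frame for $\mathcal H$ with fusion frame bounds $\alpha\le\beta$ and let $\mathcal V=((V_i,d_i))_{i\in I}$ be a $\mu$-perturbation of $\mathcal W$, where $0<\mu<\sqrt{\alpha}$. If both sequences $(c_i)_{i\in I}$ and $(d_i)_{i\in I}$ are bounded from below by some $\tau>0$, then the canonical FF-dual $\widetilde{\mathcal V}$ of $\mathcal V$ is a $C\mu$-perturbation of the canonical FF-dual $\widetilde{\mathcal W}$ of $\mathcal W$, where $$C=\frac{c^2+d^2}{\alpha}\left[\frac{1+(\alpha^{-1}+\beta)^2}{\sqrt{\alpha}}\left(\frac{\sqrt2}{\tau}+cd^2\right)+d^2\left(1+c^2d^2\right)\right]$$ with $c:=2\sqrt{\beta}+\mu$ and $d:=(\sqrt{\alpha}-\mu)^{-1}$.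
   Context: $\mathcal H$ is a Hilbert space, $I\subset\mathbb N$ a finite or countable index set, $\ell^2(I,\mathcal H)$ the Hilbert space of square-summable $\mathcal H$-valued sequences, and $P_V$ the orthogonal projection onto a closed subspace $V$. A fusion sequence is a sequence of pairs $\mathcal W=((W_i,c_i))_{i\in I}$ of closed subspaces $W_i\subset\mathcal H$ and real numbers $c_i\ge0$ such that $W_i=\{0\}\Leftrightarrow c_i=0$. It is a Bessel fusion sequence if there is $\beta>0$ with $\sum_{i\in I}c_i^2\|P_{W_i}x\|^2\le\beta\|x\|^2$ for all $x\in\mathcal H$, and a fusion frame for $\mathcal H$ with (fusion frame) bounds $\alpha\le\beta$, $\alpha,\beta>0$, if $\alpha\|x\|^2\le\sum_{i\in I}c_i^2\|P_{W_i}x\|^2\le\beta\|x\|^2$ for all $x\in\mathcal H$. For a Bessel fusion sequence, the analysis operator is $T_{\mathcal W}:\mathcal H\to\ell^2(I,\mathcal H)$, $T_{\mathcal W}x=(c_iP_{W_i}x)_{i\in I}$, and the fusion frame operator is $S_{\mathcal W}=T_{\mathcal W}^*T_{\mathcal W}$, which is boundedly invertible if $\mathcal W$ is a fusion frame. For $\mu>0$, two Bessel fusion sequences $\mathcal V,\mathcal W$ (indexed by $I$) are $\mu$-perturbations of one another if $\|T_{\mathcal W}-T_{\mathcal V}\|\le\mu$. The canonical FF-dual (canonical fusion frame dual) of a fusion frame $\mathcal W$ is the Bessel fusion sequence $\widetilde{\mathcal W}:=((S_{\mathcal W}^{-1}W_i,\ c_i\|S_{\mathcal W}^{-1}|W_i\|))_{i\in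 I}$, where $S_{\mathcal W}^{-1}|W_i$ is the restriction to $W_i$. (If $\mu<\sqrt\alpha$, a $\mu$-perturbation of a fusion frame with lower bound $\alpha$ is itself a fusion frame for $\mathcal H$, so its canonical FF-dual is defined.) *)

theory Defs
  imports "HOL-Analysis.Analysis"
begin

text \<open>
  The ambient Hilbert space is a type of class \<open>{real_inner, complete_space}\<close>. A complex Hilbert
  space is covered through its underlying real Hilbert space, with inner product
  \<open>Re \<langle>x, y\<rangle>\<close>: a closed complex subspace is a closed real subspace with the same orthogonal
  projection, and norms, operator norms and adjoints of complex linear operators do not change.
\<close>

subsection \<open>Square-summable sequences\<close>

typedef (overloaded) 'a ell2 =
  "{f :: nat \<Rightarrow> 'a::real_inner. (\<lambda>i. (norm (f i))\<^sup>2) summable_on UNIV}"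
  morphisms ell2_nth Abs_ell2
  by (rule exI[of _ "\<lambda>_. 0"]) simp

setup_lifting type_definition_ell2

lemma ell2_inner_summable:
  fixes f g :: "nat \<Rightarrow> 'a::real_inner"
  assumes "(\<lambda>i. (norm (f i))\<^sup>2) summable_on UNIV" "(\<lambda>i. (norm (g i))\<^sup>2) summable_on UNIV"
  shows "(\<lambda>i. f i \<bullet> g i) summable_on UNIV"
proof -
  have s: "(\<lambda>i. (norm (f i))\<^sup>2 + (norm (g i))\<^sup>2) summable_on UNIV"
    by (intro summable_on_add assms)
  have "norm (f i \<bullet> g i) \<le> (norm (f i))\<^sup>2 + (norm (g i))\<^sup>2" for i
  proof -
    have "\<bar>f i \<bullet> g i\<bar> \<le> norm (f i) * norm (g i)" by (rule Cauchy_Schwarz_ineq2)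
    moreover have "2 * (norm (f i) * norm (g i)) \<le> (norm (f i))\<^sup>2 + (norm (g i))\<^sup>2"
      using sum_squares_bound[of "norm (f i)" "norm (g i)"] by simp
    moreover have "0 \<le> norm (f i) * norm (g i)" by simp
    ultimately show ?thesis unfolding real_norm_def by linarith
  qed
  then have "(\<lambda>i. norm (f i \<bullet> g i)) summable_on UNIV"
    by (intro summable_on_comparison_test[OF s]) auto
  then show ?thesis by (rule abs_summable_summable)
qed

lemma ell2_add_summable:
  fixes f g :: "nat \<Rightarrow> 'a::real_inner"
  assumes "(\<lambda>i. (norm (f i))\<^sup>2) summable_on UNIV" "(\<lambda>i. (norm (g i))\<^sup>2) summable_on UNIV"
  shows "(\<lambda>i. (norm (f i + g i))\<^sup>2) summable_on UNIV"
proof -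
  have "(\<lambda>i. (norm (f i))\<^sup>2 + (norm (g i))\<^sup>2 + 2 * (f i \<bullet> g i)) summable_on UNIV"
    by (intro summable_on_add summable_on_cmult_right assms ell2_inner_summable)
  moreover have "(norm (f i + g i))\<^sup>2 = (norm (f i))\<^sup>2 + (norm (g i))\<^sup>2 + 2 * (f i \<bullet> g i)" for i
    by (simp add: power2_norm_eq_inner inner_add_left inner_add_right inner_commute)
  ultimately show ?thesis by simp
qed

lemma ell2_scale_summable:
  fixes f :: "nat \<Rightarrow> 'a::real_inner"
  assumes "(\<lambda>i. (norm (f i))\<^sup>2) summable_on UNIV"
  shows "(\<lambda>i. (norm (r *\<^sub>R f i))\<^sup>2) summable_on UNIV"
  using summable_on_cmult_right[OF assms, of "r\<^sup>2"] by (simp add: power_mult_distrib)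

instantiation ell2 :: (real_inner) real_inner
begin

lift_definition zero_ell2 :: "'a ell2" is "\<lambda>_. 0" by simp

lift_definition plus_ell2 :: "'a ell2 \<Rightarrow> 'a ell2 \<Rightarrow> 'a ell2" is "\<lambda>f g i. f i + g i"
  by (rule ell2_add_summable)

lift_definition uminus_ell2 :: "'a ell2 \<Rightarrow> 'a ell2" is "\<lambda>f i. - f i" by simp

lift_definition minus_ell2 :: "'a ell2 \<Rightarrow> 'a ell2 \<Rightarrow> 'a ell2" is "\<lambda>f g i. f i - g i"
proof -
  fix f g :: "nat \<Rightarrow> 'a"
  assume "(\<lambda>i. (norm (f i))\<^sup>2) summable_on UNIV" "(\<lambda>i. (norm (g i))\<^sup>2) summable_on UNIV"
  then show "(\<lambda>i. (norm (f i - g i))\<^sup>2) summable_on UNIV"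
    using ell2_add_summable[of f "\<lambda>i. - g i"] by simp
qed

lift_definition scaleR_ell2 :: "real \<Rightarrow> 'a ell2 \<Rightarrow> 'a ell2" is "\<lambda>r f i. r *\<^sub>R f i"
  by (rule ell2_scale_summable)

lift_definition inner_ell2 :: "'a ell2 \<Rightarrow> 'a ell2 \<Rightarrow> real" is
  "\<lambda>f g. \<Sum>\<^sub>\<infinity>i. f i \<bullet> g i" .

definition norm_ell2 :: "'a ell2 \<Rightarrow> real" where "norm_ell2 f = sqrt (f \<bullet> f)"

definition sgn_ell2 :: "'a ell2 \<Rightarrow> 'a ell2" where "sgn_ell2 f = inverse (norm f) *\<^sub>R f"

definition dist_ell2 :: "'a ell2 \<Rightarrow> 'a ell2 \<Rightarrow> real" where "dist_ell2 f g = norm (f - g)"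

definition uniformity_ell2 :: "('a ell2 \<times> 'a ell2) filter" where
  "uniformity_ell2 = (INF e\<in>{0<..}. principal {(x, y). dist x y < e})"

definition open_ell2 :: "'a ell2 set \<Rightarrow> bool" where
  "open_ell2 U = (\<forall>x\<in>U. \<forall>\<^sub>F (x', y) in uniformity. x' = x \<longrightarrow> y \<in> U)"

instance
proof
  fix f g h :: "'a ell2" and r s :: real
  show "f + g + h = f + (g + h)" by transfer (simp add: add.assoc)
  show "f + g = g + f" by transfer (simp add: add.commute)
  show "0 + f = f" by transfer simp
  show "- f + f = 0" by transfer simp
  show "f - g = f + - g" by transfer simp
  show "r *\<^sub>R (f + g) = r *\<^sub>R f + r *\<^sub>R g" by transfer (simp add: scaleR_add_right)
  show "(r + s) *\<^sub>R f = r *\<^sub>R f + s *\<^sub>R f" by transfer (simp add: scaleR_add_left)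
  show "r *\<^sub>R s *\<^sub>R f = (r * s) *\<^sub>R f" by transfer simp
  show "1 *\<^sub>R f = f" by transfer simp
  show "dist f g = norm (f - g)" by (rule dist_ell2_def)
  show "sgn f = inverse (norm f) *\<^sub>R f" by (rule sgn_ell2_def)
  show "norm f = sqrt (f \<bullet> f)" by (rule norm_ell2_def)
  show "uniformity = (INF e\<in>{0<..}. principal {(x, y). dist (x :: 'a ell2) y < e})"
    by (rule uniformity_ell2_def)
  show "open U = (\<forall>x\<in>U. \<forall>\<^sub>F (x', y) in uniformity. x' = x \<longrightarrow> y \<in> U)" for U :: "'a ell2 set"
    by (rule open_ell2_def)
  show "f \<bullet> g = g \<bullet> f" by transfer (simp add: inner_commute)
  show "(f + g) \<bullet> h = f \<bullet> h + g \<bullet> h"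
    by transfer (simp add: inner_add_left infsum_add ell2_inner_summable)
  show "(r *\<^sub>R f) \<bullet> g = r * (f \<bullet> g)"
    by transfer (simp add: infsum_cmult_right')
  show "0 \<le> f \<bullet> f"
    by transfer (simp add: infsum_nonneg)
  show "(f \<bullet> f = 0) = (f = 0)"
  proof transfer
    fix f :: "nat \<Rightarrow> 'a"
    assume s: "(\<lambda>i. (norm (f i))\<^sup>2) summable_on UNIV"
    have sm: "(\<lambda>i. f i \<bullet> f i) summable_on UNIV" by (rule ell2_inner_summable[OF s s])
    show "((\<Sum>\<^sub>\<infinity>i. f i \<bullet> f i) = 0) = (f = (\<lambda>_. 0))"
    proof
      assume z: "(\<Sum>\<^sub>\<infinity>i. f i \<bullet> f i) = 0"
      show "f = (\<lambda>_. 0)"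
      proof
        fix i
        have "f i \<bullet> f i = 0"
          by (rule nonneg_infsum_le_0D[OF eq_refl[OF z] sm]) simp_all
        then show "f i = 0" by simp
      qed
    next
      assume "f = (\<lambda>_. 0)"
      then show "(\<Sum>\<^sub>\<infinity>i. f i \<bullet> f i) = 0" by simp
    qed
  qed
qed

end

subsection \<open>Fusion frames\<close>

definition orth_proj :: "'a::real_inner set \<Rightarrow> 'a \<Rightarrow> 'a" where
  "orth_proj V x = (THE y. y \<in> V \<and> (\<forall>v\<in>V. (x - y) \<bullet> v = 0))"

definition onorm_on :: "'a::real_normed_vector set \<Rightarrow> ('a \<Rightarrow> 'b::real_normed_vector) \<Rightarrow> real" where
  "onorm_on V f = (SUP x\<in>V. norm (f x) / norm x)"

text \<open>Only the entries of a sequence at indices in the index set \<open>I\<close> are relevant.\<close>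

type_synonym 'a fusion_seq = "nat \<Rightarrow> 'a set \<times> real"

abbreviation fsubspace :: "'a fusion_seq \<Rightarrow> nat \<Rightarrow> 'a set" where
  "fsubspace W i \<equiv> fst (W i)"

abbreviation fweight :: "'a fusion_seq \<Rightarrow> nat \<Rightarrow> real" where
  "fweight W i \<equiv> snd (W i)"

definition fusion_sequence :: "nat set \<Rightarrow> 'a::real_inner fusion_seq \<Rightarrow> bool" where
  "fusion_sequence I W \<longleftrightarrow>
     (\<forall>i\<in>I. subspace (fsubspace W i) \<and> closed (fsubspace W i) \<and> fweight W i \<ge> 0 \<and>
            (fsubspace W i = {0} \<longleftrightarrow> fweight W i = 0))"

definition bessel_fusion_sequence :: "nat set \<Rightarrow> 'a::real_inner fusion_seq \<Rightarrow> bool" where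
  "bessel_fusion_sequence I W \<longleftrightarrow> fusion_sequence I W \<and>
     (\<exists>\<beta>>0. \<forall>x.
        (\<lambda>i. (fweight W i)\<^sup>2 * (norm (orth_proj (fsubspace W i) x))\<^sup>2) summable_on I \<and>
        (\<Sum>\<^sub>\<infinity>i\<in>I. (fweight W i)\<^sup>2 * (norm (orth_proj (fsubspace W i) x))\<^sup>2) \<le> \<beta> * (norm x)\<^sup>2)"

definition fusion_frame :: "nat set \<Rightarrow> 'a::real_inner fusion_seq \<Rightarrow> real \<Rightarrow> real \<Rightarrow> bool" where
  "fusion_frame I W \<alpha> \<beta> \<longleftrightarrow> fusion_sequence I W \<and> 0 < \<alpha> \<and> 0 < \<beta> \<and> \<alpha> \<le> \<beta> \<and>
     (\<forall>x.
        (\<lambda>i. (fweight W i)\<^sup>2 * (norm (orth_proj (fsubspace W i) x))\<^sup>2) summable_on I \<and>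
        \<alpha> * (norm x)\<^sup>2 \<le>
          (\<Sum>\<^sub>\<infinity>i\<in>I. (fweight W i)\<^sup>2 * (norm (orth_proj (fsubspace W i) x))\<^sup>2) \<and>
        (\<Sum>\<^sub>\<infinity>i\<in>I. (fweight W i)\<^sup>2 * (norm (orth_proj (fsubspace W i) x))\<^sup>2) \<le> \<beta> * (norm x)\<^sup>2)"

text \<open>The space $\ell^2(I, H)$ is identified with the sequences in \<open>'a ell2\<close> that vanish off \<open>I\<close>.\<close>

definition analysis_op :: "nat set \<Rightarrow> 'a::real_inner fusion_seq \<Rightarrow> 'a \<Rightarrow> 'a ell2" where
  "analysis_op I W x =
     Abs_ell2 (\<lambda>i. if i \<in> I then fweight W i *\<^sub>R orth_proj (fsubspace W i) x else 0)"

definition frame_op :: "nat set \<Rightarrow> 'a::real_inner fusion_seq \<Rightarrow> 'a \<Rightarrow> 'a" where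
  "frame_op I W = adjoint (analysis_op I W) \<circ> analysis_op I W"

definition fusion_perturbation ::
    "nat set \<Rightarrow> real \<Rightarrow> 'a::real_inner fusion_seq \<Rightarrow> 'a fusion_seq \<Rightarrow> bool" where
  "fusion_perturbation I \<mu> V W \<longleftrightarrow>
     0 < \<mu> \<and> bessel_fusion_sequence I V \<and> bessel_fusion_sequence I W \<and>
     onorm (\<lambda>x. analysis_op I W x - analysis_op I V x) \<le> \<mu>"

definition canonical_dual :: "nat set \<Rightarrow> 'a::real_inner fusion_seq \<Rightarrow> 'a fusion_seq" where
  "canonical_dual I W = (\<lambda>i.
     (inv (frame_op I W) ` fsubspace W i,
      fweight W i * onorm_on (fsubspace W i) (inv (frame_op I W))))"

end

theory Submission
  imports Defs
begin

text \<open>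
  Let \<open>S\<close> be the frame operator of \<open>W\<close>, \<open>R = S\<^sup>-\<^sup>1\<close>, and let \<open>P\<close>, \<open>\<Pi>\<close>, \<open>\<gamma>\<close>, \<open>w\<close> denote the
  projections onto \<open>W\<^sub>i\<close> and \<open>R W\<^sub>i\<close>, the norm of \<open>R\<close> on \<open>W\<^sub>i\<close> and the weight; primes mark the same
  data of \<open>V\<close>. Since \<open>\<Pi> = \<Pi> S P R\<close>, the \<open>i\<close>-th components of the dual analysis operators differ by
  \<open>w \<gamma> \<Pi> - w' \<gamma>' \<Pi>' = \<gamma>' \<Pi>' S' (w P R - w' P' R') + (\<gamma> \<Pi> S - \<gamma>' \<Pi>' S') (w P R)\<close>.
  The rightmost factors are the components of \<open>T R - T' R'\<close> and \<open>T R\<close>, so square-summability and the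
  order \<open>\<mu>\<close> of the first summand come from there, and the remaining factors only have to be bounded
  in operator norm uniformly in \<open>i\<close>. For \<open>\<Pi> - \<Pi>'\<close> and \<open>P - P'\<close> this follows from bounds on the
  gap between the subspaces; as a nearest point is not worse than \<open>(w' / w) P' m\<close>, the gap between
  \<open>W\<^sub>i\<close> and \<open>V\<^sub>i\<close> is at most \<open>\<mu> / \<tau>\<close>.
\<close>

section \<open>Orthogonal projections in Hilbert spaces\<close>

locale closed_subspace =
  fixes V :: "'a::{real_inner, complete_space} set"
  assumes subspace: "subspace V" and closed: "closed V"
begin

text \<open>A minimizing sequence for the distance from \<open>x\<close> to \<open>V\<close> is
  Cauchy by the parallelogram law. Its limit is a nearest point of \<open>V\<close>, and varying
  that point along \<open>v\<close> gives orthogonality.\<close>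

lemma orth_proj_exists: "\<exists>y\<in>V. \<forall>v\<in>V. (x - y) \<bullet> v = 0"
proof -
  define D where "D = (INF v\<in>V. (norm (x - v))\<^sup>2)"
  have bdd: "bdd_below ((\<lambda>v. (norm (x - v))\<^sup>2) ` V)"
    by (rule bdd_belowI[of _ 0]) auto
  have ne: "V \<noteq> {}" using subspace_0[OF subspace] by auto
  have D_le: "D \<le> (norm (x - v))\<^sup>2" if "v \<in> V" for v
    unfolding D_def using bdd that by (rule cINF_lower)
  have "\<exists>v\<in>V. (norm (x - v))\<^sup>2 < D + inverse (real (Suc n))" for n
    using cINF_less_iff[OF ne bdd, of "D + inverse (real (Suc n))"] by (simp add: D_def)
  then obtain y where yV: "\<And>n. y n \<in> V"
    and y: "\<And>n. (norm (x - y n))\<^sup>2 < D + inverse (real (Suc n))"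
    by metis
  have par: "(norm (y m - y n))\<^sup>2 \<le> 2 * inverse (real (Suc m)) + 2 * inverse (real (Suc n))" for m n
  proof -
    have "(1/2) *\<^sub>R (y m + y n) \<in> V"
      by (intro subspace_scale subspace_add subspace yV)
    then have "D \<le> (norm (x - (1/2) *\<^sub>R (y m + y n)))\<^sup>2" by (rule D_le)
    \<comment> \<open>Parallelogram identity for \<open>x - y m\<close> and \<open>x - y n\<close>;
      the midpoint lies in \<open>V\<close>, so its squared distance to \<open>x\<close> is at least
      \<open>D\<close>.\<close>
    moreover have "(norm (y m - y n))\<^sup>2 + 4 * (norm (x - (1/2) *\<^sub>R (y m + y n)))\<^sup>2
        = 2 * (norm (x - y m))\<^sup>2 + 2 * (norm (x - y n))\<^sup>2"
      by (simp add: power2_norm_eq_inner inner_diff_left inner_diff_right inner_add_left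
          inner_add_right inner_commute algebra_simps)
    ultimately show ?thesis using y[of m] y[of n] by linarith
  qed
  have "Cauchy y"
  proof (rule CauchyI)
    fix e :: real assume e: "0 < e"
    obtain N where N: "inverse (real (Suc N)) < e\<^sup>2 / 4"
      using reals_Archimedean[of "e\<^sup>2 / 4"] e by auto
    have "norm (y m - y n) < e" if "m \<ge> N" "n \<ge> N" for m n
    proof -
      have "inverse (real (Suc m)) \<le> inverse (real (Suc N))"
        "inverse (real (Suc n)) \<le> inverse (real (Suc N))"
        using that by (auto intro!: le_imp_inverse_le)
      then have "(norm (y m - y n))\<^sup>2 < e\<^sup>2" using par[of m n] N by linarith
      then show ?thesis using e by (simp add: power2_less_imp_less)
    qed
    then show "\<exists>M. \<forall>m\<ge>M. \<forall>n\<ge>M. norm (y m - y n) < e" by blast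
  qed
  then obtain l where l: "y \<longlonglongrightarrow> l"
    using Cauchy_convergent_iff convergent_def by blast
  have lV: "l \<in> V" using closed_sequentially[OF closed _ l] yV by blast
  have "(\<lambda>n. (norm (x - y n))\<^sup>2) \<longlonglongrightarrow> (norm (x - l))\<^sup>2"
    by (intro tendsto_intros l)
  moreover have "(\<lambda>n. D + inverse (real (Suc n))) \<longlonglongrightarrow> D + 0"
    by (intro tendsto_intros LIMSEQ_inverse_real_of_nat)
  ultimately have l_min: "(norm (x - l))\<^sup>2 \<le> D"
    using LIMSEQ_le[of _ _ _ "D + 0"] y less_imp_le by (metis (no_types, lifting) add.right_neutral)
  have "(x - l) \<bullet> v = 0" if "v \<in> V" for v
  proof (cases "v = 0")
    case False
    \<comment> \<open>The coefficient of the projection of \<open>x - l\<close> onto the line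
      through \<open>v\<close>; it minimizes the quadratic in \<open>t\<close> below.\<close>
    define t where "t = ((x - l) \<bullet> v) / (v \<bullet> v)"
    have vv: "v \<bullet> v > 0" using False by simp
    have "l + t *\<^sub>R v \<in> V" by (intro subspace_add subspace_scale subspace lV that)
    then have "(norm (x - l))\<^sup>2 \<le> (norm ((x - l) - t *\<^sub>R v))\<^sup>2"
      using D_le l_min by (metis diff_diff_add order_trans)
    also have "\<dots> = (norm (x - l))\<^sup>2 - 2 * t * ((x - l) \<bullet> v) + t * t * (v \<bullet> v)"
      unfolding power2_norm_eq_inner
      by (simp add: inner_diff_left inner_diff_right inner_commute algebra_simps)
    also have "\<dots> = (norm (x - l))\<^sup>2 - ((x - l) \<bullet> v)\<^sup>2 / (v \<bullet> v)"
      using vv by (simp add: t_def power2_eq_square)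
    finally have "((x - l) \<bullet> v)\<^sup>2 / (v \<bullet> v) \<le> 0" by simp
    then show ?thesis using vv by (simp add: divide_le_0_iff)
  qed simp
  then show ?thesis using lV by blast
qed

lemma orth_proj_eqI:
  assumes "y \<in> V" "\<And>v. v \<in> V \<Longrightarrow> (x - y) \<bullet> v = 0"
  shows "orth_proj V x = y"
  unfolding orth_proj_def
proof (rule the_equality)
  fix z assume z: "z \<in> V \<and> (\<forall>v\<in>V. (x - z) \<bullet> v = 0)"
  then have "z - y \<in> V" using assms(1) subspace subspace_diff by blast
  then have "(x - y) \<bullet> (z - y) - (x - z) \<bullet> (z - y) = 0" using z assms(2) by simp
  then have "(z - y) \<bullet> (z - y) = 0" by (simp add: inner_diff_left)
  then show "z = y" by simp
qed (intro conjI ballI assms)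

lemma orth_proj_in: "orth_proj V x \<in> V"
  and orth_proj_orth: "v \<in> V \<Longrightarrow> (x - orth_proj V x) \<bullet> v = 0"
proof -
  obtain y where y: "y \<in> V" "\<And>v. v \<in> V \<Longrightarrow> (x - y) \<bullet> v = 0"
    using orth_proj_exists by blast
  then have "orth_proj V x = y" by (rule orth_proj_eqI)
  with y show "orth_proj V x \<in> V" "v \<in> V \<Longrightarrow> (x - orth_proj V x) \<bullet> v = 0" by simp_all
qed

lemma orth_proj_inner: "v \<in> V \<Longrightarrow> orth_proj V x \<bullet> v = x \<bullet> v"
  by (drule orth_proj_orth[of _ x]) (simp add: inner_diff_left)

lemma orth_proj_id: "x \<in> V \<Longrightarrow> orth_proj V x = x"
  by (rule orth_proj_eqI) auto

lemma orth_proj_pythagoras: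
  "(norm x)\<^sup>2 = (norm (orth_proj V x))\<^sup>2 + (norm (x - orth_proj V x))\<^sup>2"
proof -
  have "orthogonal (orth_proj V x) (x - orth_proj V x)"
    unfolding orthogonal_def by (subst inner_commute) (rule orth_proj_orth[OF orth_proj_in])
  from norm_add_Pythagorean[OF this] show ?thesis by simp
qed

lemma norm_orth_proj_le: "norm (orth_proj V x) \<le> norm x"
  by (rule power2_le_imp_le) (subst orth_proj_pythagoras, simp_all)

lemma orth_proj_best:
  assumes "v \<in> V"
  shows "norm (x - orth_proj V x) \<le> norm (x - v)"
proof (rule power2_le_imp_le)
  have "orth_proj V x - v \<in> V" by (intro subspace_diff subspace orth_proj_in assms)
  then have "(x - orth_proj V x) \<bullet> (orth_proj V x - v) = 0" by (rule orth_proj_orth)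
  then have "(norm ((x - orth_proj V x) + (orth_proj V x - v)))\<^sup>2
      = (norm (x - orth_proj V x))\<^sup>2 + (norm (orth_proj V x - v))\<^sup>2"
    by (intro norm_add_Pythagorean) (simp add: orthogonal_def)
  then show "(norm (x - orth_proj V x))\<^sup>2 \<le> (norm (x - v))\<^sup>2" by simp
qed simp

lemma orth_proj_bounded_linear: "bounded_linear (orth_proj V)"
proof (rule bounded_linear_intro[of _ 1])
  show "orth_proj V (x + y) = orth_proj V x + orth_proj V y" for x y
    by (rule orth_proj_eqI)
      (auto intro!: subspace_add subspace orth_proj_in
        simp: inner_diff_left inner_add_left orth_proj_inner)
  show "orth_proj V (r *\<^sub>R x) = r *\<^sub>R orth_proj V x" for r x
    by (rule orth_proj_eqI)
      (auto intro!: subspace_scale subspace orth_proj_in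
        simp: inner_diff_left orth_proj_inner)
qed (simp add: norm_orth_proj_le)

lemmas orth_proj_diff = linear_diff[OF bounded_linear.linear[OF orth_proj_bounded_linear]]

end

text \<open>With \<open>z\<close> the component of \<open>x\<close> orthogonal to \<open>N\<close>,
  the difference splits into \<open>orth_proj M z\<close>, in \<open>M\<close>, and a vector
  orthogonal to \<open>M\<close>. Hypothesis \<open>MN\<close> controls the first part by duality
  and \<open>NM\<close> the second, and Pythagoras recombines them with the same constant
  \<open>k\<close>.\<close>

lemma orth_proj_gap:
  fixes M N :: "'a::{real_inner, complete_space} set"
  assumes "closed_subspace M" "closed_subspace N"
    and MN: "\<And>m. m \<in> M \<Longrightarrow> norm (m - orth_proj N m) \<le> k * norm m"
    and NM: "\<And>n. n \<in> N \<Longrightarrow> norm (n - orth_proj M n) \<le> k * norm n"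
    and k: "0 \<le> k"
  shows "norm (orth_proj M x - orth_proj N x) \<le> k * norm x"
proof (rule power2_le_imp_le)
  interpret M: closed_subspace M by fact
  interpret N: closed_subspace N by fact
  define z where "z = x - orth_proj N x"
  have z: "norm (orth_proj M z) \<le> k * norm z"
  proof (cases "orth_proj M z = 0")
    case False
    have "(norm (orth_proj M z))\<^sup>2 = orth_proj M z \<bullet> z"
      unfolding power2_norm_eq_inner M.orth_proj_inner[OF M.orth_proj_in] by (rule inner_commute)
    \<comment> \<open>As \<open>z\<close> is orthogonal to \<open>N\<close>, subtracting the
      projection of \<open>orth_proj M z\<close> onto \<open>N\<close> does not change the inner
      product, and the remainder is what \<open>MN\<close> bounds.\<close>
    also have "\<dots> = (orth_proj M z - orth_proj N (orth_proj M z)) \<bullet> z"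
      using N.orth_proj_orth[OF N.orth_proj_in, of x "orth_proj M z"]
      by (simp only: inner_commute[of _ z] z_def[symmetric]) (simp add: inner_diff_right)
    also have "\<dots> \<le> norm (orth_proj M z - orth_proj N (orth_proj M z)) * norm z"
      by (rule norm_cauchy_schwarz)
    also have "\<dots> \<le> (k * norm (orth_proj M z)) * norm z"
      by (intro mult_right_mono MN M.orth_proj_in) simp
    finally show ?thesis using False by (simp add: power2_eq_square)
  qed (use k in simp)
  have eq: "orth_proj M x - orth_proj N x
      = orth_proj M z + - (orth_proj N x - orth_proj M (orth_proj N x))"
    by (simp add: z_def M.orth_proj_diff)
  have "(norm (orth_proj M x - orth_proj N x))\<^sup>2
      = (norm (orth_proj M z))\<^sup>2 + (norm (orth_proj N x - orth_proj M (orth_proj N x)))\<^sup>2"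
  proof -
    have "orthogonal (orth_proj M z) (- (orth_proj N x - orth_proj M (orth_proj N x)))"
      unfolding orthogonal_def inner_minus_right
      by (subst inner_commute) (simp only: M.orth_proj_orth[OF M.orth_proj_in] minus_zero)
    then show ?thesis unfolding eq by (simp only: norm_add_Pythagorean norm_minus_cancel)
  qed
  also have "\<dots> \<le> (k * norm z)\<^sup>2 + (k * norm (orth_proj N x))\<^sup>2"
    by (intro add_mono power_mono z NM N.orth_proj_in) auto
  also have "\<dots> = (k * norm x)\<^sup>2"
    using N.orth_proj_pythagoras[of x] by (simp add: z_def power_mult_distrib algebra_simps)
  finally show "(norm (orth_proj M x - orth_proj N x))\<^sup>2 \<le> (k * norm x)\<^sup>2" .
qed (use k in simp)

section \<open>Riesz representation and adjoints\<close>

text \<open>The component \<open>z\<close> of some \<open>x0\<close> outside the kernel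
  \<open>K\<close> that is orthogonal to \<open>K\<close> represents \<open>f\<close> up to a
  scalar: each \<open>x\<close> differs from a multiple of \<open>z\<close> by an element of
  \<open>K\<close>.\<close>

lemma riesz_representation:
  fixes f :: "'a::{real_inner, complete_space} \<Rightarrow> real"
  assumes "bounded_linear f"
  shows "\<exists>y. \<forall>x. f x = x \<bullet> y"
proof (cases "\<forall>x. f x = 0")
  case True
  then show ?thesis by (intro exI[of _ 0]) simp
next
  case False
  interpret f: bounded_linear f by fact
  obtain x0 where x0: "f x0 \<noteq> 0" using False by blast
  define K where "K = {x. f x = 0}"
  interpret K: closed_subspace K
  proof
    show "subspace K" by (auto simp: K_def subspace_def f.add f.scaleR f.zero)
    show "closed K"
      unfolding K_def using assms
      by (intro closed_Collect_eq continuous_intros linear_continuous_on)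
  qed
  define z where "z = x0 - orth_proj K x0"
  have fz: "f z \<noteq> 0" using K.orth_proj_in[of x0] x0 by (simp add: z_def f.diff K_def)
  then have zz: "z \<bullet> z \<noteq> 0" using f.zero by auto
  have "f x = x \<bullet> ((f z / (z \<bullet> z)) *\<^sub>R z)" for x
  proof -
    have "x - (f x / f z) *\<^sub>R z \<in> K" using fz by (simp add: K_def f.diff f.scaleR)
    then have "z \<bullet> (x - (f x / f z) *\<^sub>R z) = 0" unfolding z_def by (rule K.orth_proj_orth)
    then have "x \<bullet> z = (f x / f z) * (z \<bullet> z)" by (simp add: inner_diff_right inner_commute)
    then show ?thesis using fz zz by simp
  qed
  then show ?thesis by blast
qed

text \<open>\<open>adjoint\<close> is defined by choice, so its characteristic equation holds once
  some adjoint exists; Riesz representation provides one for each \<open>y\<close>.\<close>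

lemma inner_adjoint:
  fixes f :: "'a::{real_inner, complete_space} \<Rightarrow> 'b::real_inner"
  assumes "bounded_linear f"
  shows "f x \<bullet> y = x \<bullet> adjoint f y"
proof -
  have "\<exists>z. \<forall>x. f x \<bullet> y = x \<bullet> z" for y
    by (rule riesz_representation)
      (rule bounded_linear_compose[OF bounded_linear_inner_left assms])
  then have "\<exists>g. \<forall>x y. f x \<bullet> y = x \<bullet> g y" by metis
  then have "\<forall>x y. f x \<bullet> y = x \<bullet> adjoint f y"
    unfolding adjoint_def by (rule someI_ex)
  then show ?thesis by blast
qed

lemma norm_le_of_inner:
  fixes u :: "'a::real_inner"
  assumes "\<And>y. u \<bullet> y \<le> k * norm y" "0 \<le> k"
  shows "norm u \<le> k"
proof (cases "u = 0")
  case False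
  then show ?thesis using assms(1)[of u] by (simp add: power2_norm_eq_inner[symmetric] power2_eq_square)
qed (simp add: assms(2))

section \<open>Square-summable sequences and analysis operators\<close>

lemma ell2_summable: "(\<lambda>i. (norm (ell2_nth f i))\<^sup>2) summable_on UNIV"
  using ell2_nth[of f] by simp

lemma ell2_eqI: "(\<And>i. ell2_nth f i = ell2_nth g i) \<Longrightarrow> f = g"
  by (metis ell2_nth_inject ext)

lemma norm_ell2_sq: "(norm f)\<^sup>2 = (\<Sum>\<^sub>\<infinity>i. (norm (ell2_nth f i))\<^sup>2)"
  unfolding power2_norm_eq_inner by transfer simp

lemma norm_ell2_nth_le: "norm (ell2_nth f i) \<le> norm f"
proof (rule power2_le_imp_le)
  show "(norm (ell2_nth f i))\<^sup>2 \<le> (norm f)\<^sup>2"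
    unfolding norm_ell2_sq
    using finite_sum_le_infsum[OF ell2_summable[of f], of "{i}"] by simp
qed simp

lemma ell2_dominated_summable:
  assumes "\<And>i. norm (f i) \<le> k * norm (ell2_nth u i)"
  shows "(\<lambda>i. (norm (f i))\<^sup>2) summable_on UNIV"
proof (rule summable_on_comparison_test)
  show "(\<lambda>i. k\<^sup>2 * (norm (ell2_nth u i))\<^sup>2) summable_on UNIV"
    by (intro summable_on_cmult_right ell2_summable)
  show "(norm (f i))\<^sup>2 \<le> k\<^sup>2 * (norm (ell2_nth u i))\<^sup>2" for i
    using power_mono[OF assms norm_ge_zero, of i 2] by (simp add: power_mult_distrib)
qed simp

lemma norm_ell2_mono:
  assumes "\<And>i. norm (ell2_nth f i) \<le> k * norm (ell2_nth u i)" "0 \<le> k"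
  shows "norm f \<le> k * norm u"
proof (rule power2_le_imp_le)
  have "(norm f)\<^sup>2 \<le> (\<Sum>\<^sub>\<infinity>i. k\<^sup>2 * (norm (ell2_nth u i))\<^sup>2)"
    unfolding norm_ell2_sq
  proof (rule infsum_mono)
    show "(norm (ell2_nth f i))\<^sup>2 \<le> k\<^sup>2 * (norm (ell2_nth u i))\<^sup>2" for i
      using power_mono[OF assms(1) norm_ge_zero, of i 2] by (simp add: power_mult_distrib)
  qed (intro summable_on_cmult_right ell2_summable)+
  then show "(norm f)\<^sup>2 \<le> (k * norm u)\<^sup>2"
    by (simp add: infsum_cmult_right' norm_ell2_sq[of u] power_mult_distrib)
qed (use assms in simp)

text \<open>Here \<open>g\<close> and \<open>h\<close> are plain sequences. Their domination by
  square-summable sequences makes them elements of \<open>ell2\<close>, where the triangle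
  inequality applies.\<close>

lemma norm_ell2_mono2:
  fixes f :: "'a::real_inner ell2" and u v :: "'b::real_inner ell2"
  assumes eq: "\<And>i. ell2_nth f i = g i + h i"
    and g: "\<And>i. norm (g i) \<le> k * norm (ell2_nth u i)" "0 \<le> k"
    and h: "\<And>i. norm (h i) \<le> l * norm (ell2_nth v i)" "0 \<le> l"
  shows "norm f \<le> k * norm u + l * norm v"
proof -
  define G where "G = Abs_ell2 g"
  define H where "H = Abs_ell2 h"
  have G: "ell2_nth G = g"
    unfolding G_def using ell2_dominated_summable[OF g(1)] by (simp add: Abs_ell2_inverse)
  have H: "ell2_nth H = h"
    unfolding H_def using ell2_dominated_summable[OF h(1)] by (simp add: Abs_ell2_inverse)
  have "f = G + H" by (rule ell2_eqI) (simp add: plus_ell2.rep_eq G H eq)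
  then have "norm f \<le> norm G + norm H" by (simp add: norm_triangle_ineq)
  moreover have "norm G \<le> k * norm u" by (rule norm_ell2_mono) (simp_all add: G g)
  moreover have "norm H \<le> l * norm v" by (rule norm_ell2_mono) (simp_all add: H h)
  ultimately show ?thesis by linarith
qed

locale bessel_fusion =
  fixes I :: "nat set" and W :: "'a::{real_inner, complete_space} fusion_seq"
  assumes bessel: "bessel_fusion_sequence I W"
begin

abbreviation T where "T \<equiv> analysis_op I W"
abbreviation P where "P i \<equiv> orth_proj (fsubspace W i)"

lemma closed_subspace: "i \<in> I \<Longrightarrow> closed_subspace (fsubspace W i)"
  using bessel unfolding bessel_fusion_sequence_def fusion_sequence_def closed_subspace_def
  by blast

lemma analysis_op_summable:
  "(\<lambda>i. (fweight W i)\<^sup>2 * (norm (P i x))\<^sup>2) summable_on I"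
  using bessel by (auto simp: bessel_fusion_sequence_def)

text \<open>The Bessel condition makes the sequence square-summable, so \<open>Abs_ell2\<close> in
  the definition of the analysis operator can be undone.\<close>

lemma analysis_op_nth:
  "ell2_nth (T x) i = (if i \<in> I then fweight W i *\<^sub>R P i x else 0)"
proof -
  have "(\<lambda>i. (norm (if i \<in> I then fweight W i *\<^sub>R P i x else 0))\<^sup>2) summable_on UNIV
    \<longleftrightarrow> (\<lambda>i. (fweight W i)\<^sup>2 * (norm (P i x))\<^sup>2) summable_on I"
    by (rule summable_on_cong_neutral) (auto simp: power_mult_distrib)
  then have "ell2_nth (T x) = (\<lambda>i. if i \<in> I then fweight W i *\<^sub>R P i x else 0)"
    unfolding analysis_op_def using analysis_op_summable by (intro Abs_ell2_inverse) simp
  then show ?thesis by simp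
qed

lemma norm_analysis_op_sq:
  "(norm (T x))\<^sup>2 = (\<Sum>\<^sub>\<infinity>i\<in>I. (fweight W i)\<^sup>2 * (norm (P i x))\<^sup>2)"
  unfolding norm_ell2_sq
  by (rule infsum_cong_neutral) (auto simp: analysis_op_nth power_mult_distrib)

lemma analysis_op_bounded_linear: "bounded_linear T"
proof -
  obtain b where b: "b > 0"
    "\<And>x. (\<Sum>\<^sub>\<infinity>i\<in>I. (fweight W i)\<^sup>2 * (norm (P i x))\<^sup>2) \<le> b * (norm x)\<^sup>2"
    using bessel by (auto simp: bessel_fusion_sequence_def)
  have lin: "bounded_linear (P i)" if "i \<in> I" for i
    using closed_subspace[OF that] by (rule closed_subspace.orth_proj_bounded_linear)
  show ?thesis
  proof (rule bounded_linear_intro[of _ "sqrt b"])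
    show "T (x + y) = T x + T y" for x y
      by (rule ell2_eqI)
        (auto simp: analysis_op_nth plus_ell2.rep_eq scaleR_add_right
          linear_add[OF bounded_linear.linear[OF lin]])
    show "T (r *\<^sub>R x) = r *\<^sub>R T x" for r x
      by (rule ell2_eqI)
        (auto simp: analysis_op_nth scaleR_ell2.rep_eq
          linear_scale[OF bounded_linear.linear[OF lin]])
    show "norm (T x) \<le> norm x * sqrt b" for x
      by (rule power2_le_imp_le)
        (use b in \<open>simp_all add: norm_analysis_op_sq power_mult_distrib mult.commute\<close>)
  qed
qed

text \<open>Reduces properties of the frame operator to those of \<open>T\<close>, so that the
  adjoint itself need not be handled again.\<close>

lemma inner_frame_op: "frame_op I W x \<bullet> y = T x \<bullet> T y"
  unfolding frame_op_def comp_def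
  by (metis inner_adjoint[OF analysis_op_bounded_linear] inner_commute)

end

section \<open>The norm of a map on a subspace\<close>

lemma onorm_on_upper:
  assumes "\<And>x. x \<in> V \<Longrightarrow> norm (f x) \<le> k * norm x" "x \<in> V"
  shows "norm (f x) \<le> onorm_on V f * norm x"
proof (cases "x = 0")
  case True
  then show ?thesis using assms(1)[OF assms(2)] by simp
next
  case False
  \<comment> \<open>The zero vector contributes the quotient \<open>0 / 0 = 0\<close>, and
    \<open>k\<close> may be negative; hence the maximum with \<open>0\<close>.\<close>
  have "norm (f y) / norm y \<le> max k 0" if "y \<in> V" for y
  proof (cases "y = 0")
    case False
    then have "norm (f y) / norm y \<le> k" using assms(1)[OF that] by (simp add: divide_le_eq)
    then show ?thesis by simp
  qed simp
  then have "bdd_above ((\<lambda>y. norm (f y) / norm y) ` V)" by (intro bdd_aboveI2)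
  then have "norm (f x) / norm x \<le> onorm_on V f"
    unfolding onorm_on_def using assms(2) by (intro cSUP_upper)
  then show ?thesis using False by (simp add: divide_le_eq)
qed

lemma onorm_on_le:
  assumes "\<And>x. x \<in> V \<Longrightarrow> norm (f x) \<le> k * norm x" "0 \<in> V" "0 \<le> k"
  shows "onorm_on V f \<le> k"
  unfolding onorm_on_def
proof (rule cSUP_least)
  show "norm (f x) / norm x \<le> k" if "x \<in> V" for x
    using assms(1)[OF that] assms(3) by (cases "x = 0") (auto simp: divide_le_eq)
qed (use assms in auto)

lemma onorm_on_nonneg:
  assumes "\<And>x. x \<in> V \<Longrightarrow> norm (f x) \<le> k * norm x" "0 \<in> V"
  shows "0 \<le> onorm_on V f"
proof (cases "V = {0}")
  case False
  then obtain x where "x \<in> V" "x \<noteq> 0" using assms(2) by blast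
  then have "0 \<le> onorm_on V f * norm x"
    using onorm_on_upper[OF assms(1)] by (meson norm_ge_zero order_trans)
  with \<open>x \<noteq> 0\<close> show ?thesis by (simp add: zero_le_mult_iff)
qed (simp add: onorm_on_def)

section \<open>The frame operator and the canonical dual\<close>

locale frame =
  fixes I :: "nat set" and W :: "'a::{real_inner, complete_space} fusion_seq" and A B :: real
  assumes frame: "fusion_frame I W A B"
begin

lemma A_pos: "0 < A" and B_pos: "0 < B"
  using frame by (simp_all add: fusion_frame_def)

sublocale bessel_fusion I W
  using frame by unfold_locales (auto simp: fusion_frame_def bessel_fusion_sequence_def)

abbreviation S where "S \<equiv> frame_op I W"
abbreviation R where "R \<equiv> inv (frame_op I W)"
abbreviation dual_proj where "dual_proj i \<equiv> orth_proj (R ` fsubspace W i)"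
abbreviation dual_norm where "dual_norm i \<equiv> onorm_on (fsubspace W i) R"

lemma norm_analysis_op_le: "norm (T x) \<le> sqrt B * norm x"
  by (rule power2_le_imp_le) (use frame B_pos in
      \<open>simp_all add: norm_analysis_op_sq power_mult_distrib fusion_frame_def\<close>)

lemma norm_analysis_op_sq_ge: "A * (norm x)\<^sup>2 \<le> (norm (T x))\<^sup>2"
  using frame by (simp add: norm_analysis_op_sq fusion_frame_def)

lemma norm_analysis_op_ge: "sqrt A * norm x \<le> norm (T x)"
  by (rule power2_le_imp_le) (use norm_analysis_op_sq_ge A_pos in \<open>simp_all add: power_mult_distrib\<close>)

lemma norm_frame_op_le: "norm (S x) \<le> B * norm x"
proof (rule norm_le_of_inner)
  fix y
  have "S x \<bullet> y \<le> norm (T x) * norm (T y)"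
    unfolding inner_frame_op by (rule norm_cauchy_schwarz)
  also have "\<dots> \<le> (sqrt B * norm x) * (sqrt B * norm y)"
    using B_pos by (intro mult_mono norm_analysis_op_le) auto
  also have "\<dots> = B * norm x * norm y" using B_pos by (simp add: mult_ac)
  finally show "S x \<bullet> y \<le> B * norm x * norm y" .
qed (use B_pos in simp)

lemma frame_op_bounded_linear: "bounded_linear S"
proof (rule bounded_linear_intro[of _ B])
  have lin: "linear T" using analysis_op_bounded_linear by (rule bounded_linear.linear)
  have "S (x + y) \<bullet> z = (S x + S y) \<bullet> z" for x y z
    by (simp add: inner_add_left inner_frame_op linear_add[OF lin])
  then show "S (x + y) = S x + S y" for x y using vector_eq_rdot by blast
  have "S (r *\<^sub>R x) \<bullet> z = (r *\<^sub>R S x) \<bullet> z" for r x z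
    by (simp add: inner_frame_op linear_scale[OF lin])
  then show "S (r *\<^sub>R x) = r *\<^sub>R S x" for r x using vector_eq_rdot by blast
  show "norm (S x) \<le> norm x * B" for x using norm_frame_op_le[of x] by (simp add: mult.commute)
qed

lemma inner_frame_op_self_ge: "A * (norm x)\<^sup>2 \<le> S x \<bullet> x"
  using norm_analysis_op_sq_ge[of x] by (simp add: inner_frame_op power2_norm_eq_inner)

lemma norm_frame_op_ge: "A * norm x \<le> norm (S x)"
proof (cases "x = 0")
  case False
  have "A * norm x * norm x \<le> norm (S x) * norm x"
    using order_trans[OF inner_frame_op_self_ge norm_cauchy_schwarz, of x]
    by (simp add: power2_eq_square mult.assoc)
  then show ?thesis using False by simp
qed simp

text \<open>A Lax-Milgram argument: the lower bound on \<open>norm (S x)\<close> gives injectivity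
  and a complete, hence closed, range. A vector \<open>z\<close> orthogonal to the range satisfies
  \<open>z \<bullet> S z = 0\<close>, so it vanishes by coercivity.\<close>

lemma frame_op_bij: "bij S"
proof (rule bijI)
  have lin: "linear S" using frame_op_bounded_linear by (rule bounded_linear.linear)
  have "x = 0" if "S x = 0" for x
    using norm_frame_op_ge[of x] that A_pos by (simp add: mult_le_0_iff)
  then show "inj S" using linear_injective_0[OF lin] by blast
  interpret range: closed_subspace "range S"
  proof
    show "subspace (range S)" by (rule linear_subspace_image[OF lin subspace_UNIV])
    show "closed (range S)"
      by (rule complete_imp_closed, rule complete_isometric_image[OF A_pos _ frame_op_bounded_linear])
        (simp_all add: norm_frame_op_ge complete_UNIV)
  qed
  have "y \<in> range S" for y
  proof -
    define z where "z = y - orth_proj (range S) y"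
    have "z \<bullet> S z = 0" unfolding z_def by (rule range.orth_proj_orth) simp
    then have "A * (norm z)\<^sup>2 \<le> 0" using inner_frame_op_self_ge[of z] by (simp add: inner_commute)
    then have "z = 0" using A_pos by (simp add: mult_le_0_iff)
    then show ?thesis using range.orth_proj_in[of y] by (simp add: z_def)
  qed
  then show "surj S" by blast
qed

lemma frame_op_inv [simp]: "S (R x) = x"
  by (rule surj_f_inv_f[OF bij_is_surj[OF frame_op_bij]])

lemma inv_frame_op [simp]: "R (S x) = x"
  by (rule inv_f_f[OF bij_is_inj[OF frame_op_bij]])

lemma norm_inv_frame_op_le: "norm (R x) \<le> norm x / A"
  using norm_frame_op_ge[of "R x"] A_pos by (simp add: field_simps)

lemma norm_inv_frame_op_le': "norm (R x) \<le> 1 / A * norm x"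
  using norm_inv_frame_op_le by simp

lemma inv_frame_op_bounded_linear: "bounded_linear R"
proof (rule bounded_linear_intro[of _ "1 / A"])
  have lin: "linear S" using frame_op_bounded_linear by (rule bounded_linear.linear)
  show "R (x + y) = R x + R y" for x y
    using inv_frame_op[of "R x + R y"] by (simp add: linear_add[OF lin])
  show "R (r *\<^sub>R x) = r *\<^sub>R R x" for r x
    using inv_frame_op[of "r *\<^sub>R R x"] by (simp add: linear_scale[OF lin])
  show "norm (R x) \<le> norm x * (1 / A)" for x using norm_inv_frame_op_le by simp
qed

lemma frame_op_sym: "S x \<bullet> y = x \<bullet> S y"
  by (metis inner_commute inner_frame_op)

lemma inv_frame_op_sym: "R x \<bullet> y = x \<bullet> R y"
  using frame_op_sym[of "R x" "R y"] by simp

text \<open>Since the squared norm equals \<open>x \<bullet> R x\<close>, the bound depends on the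
  lower frame bound alone; composing the bounds of \<open>T\<close> and \<open>R\<close> would give
  the weaker \<open>sqrt B / A\<close>.\<close>

lemma norm_analysis_op_inv_le: "norm (T (R x)) \<le> norm x / sqrt A"
proof (rule power2_le_imp_le)
  have "(norm (T (R x)))\<^sup>2 = x \<bullet> R x"
    using inner_frame_op[of "R x" "R x"] by (simp add: power2_norm_eq_inner)
  also have "\<dots> \<le> norm x * norm (R x)" by (rule norm_cauchy_schwarz)
  also have "\<dots> \<le> norm x * (norm x / A)" by (intro mult_left_mono norm_inv_frame_op_le) simp
  also have "\<dots> = (norm x / sqrt A)\<^sup>2" using A_pos by (simp add: power_divide power2_eq_square)
  finally show "(norm (T (R x)))\<^sup>2 \<le> (norm x / sqrt A)\<^sup>2" .
qed (use A_pos in simp)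

section \<open>The canonical dual as a Bessel fusion sequence\<close>

text \<open>The image under \<open>R\<close> is the preimage under the continuous \<open>S\<close>,
  hence closed.\<close>

lemma closed_subspace_dual:
  assumes "i \<in> I"
  shows "closed_subspace (R ` fsubspace W i)"
proof
  interpret closed_subspace "fsubspace W i" using assms by (rule closed_subspace)
  show "subspace (R ` fsubspace W i)"
    using inv_frame_op_bounded_linear subspace bounded_linear.linear linear_subspace_image by blast
  have "R ` fsubspace W i = S -` fsubspace W i"
    using bij_vimage_eq_inv_image[OF frame_op_bij] by simp
  then show "closed (R ` fsubspace W i)"
    using closed_vimage[OF closed linear_continuous_on[OF frame_op_bounded_linear]] by simp
qed

text \<open>For \<open>w \<in> W\<^sub>i\<close> and \<open>z = R x\<close> we have \<open>\<langle>S (z - P\<^sub>i z), R w\<rangle> = \<langle>z - P\<^sub>i z, w\<rangle> = 0\<close>.\<close>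

lemma dual_proj_eq:
  assumes "i \<in> I"
  shows "dual_proj i x = dual_proj i (S (P i (R x)))"
proof -
  interpret W: closed_subspace "fsubspace W i" using assms by (rule closed_subspace)
  interpret D: closed_subspace "R ` fsubspace W i" using assms by (rule closed_subspace_dual)
  show ?thesis
  proof (rule D.orth_proj_eqI[OF D.orth_proj_in])
    fix v assume v: "v \<in> R ` fsubspace W i"
    then obtain w where w: "w \<in> fsubspace W i" "v = R w" by blast
    have "S (P i (R x)) \<bullet> v = P i (R x) \<bullet> w" by (simp add: frame_op_sym w)
    also have "\<dots> = x \<bullet> v" by (simp add: W.orth_proj_inner w inv_frame_op_sym)
    finally show "(x - dual_proj i (S (P i (R x)))) \<bullet> v = 0"
      by (simp add: inner_diff_left D.orth_proj_inner[OF v])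
  qed
qed

lemma norm_dual_proj_le:
  assumes "i \<in> I"
  shows "norm (dual_proj i (S x)) \<le> B * norm x"
  using closed_subspace.norm_orth_proj_le[OF closed_subspace_dual[OF assms]] norm_frame_op_le
  by (rule order_trans)

lemma fsubspace_0: "i \<in> I \<Longrightarrow> 0 \<in> fsubspace W i"
  using closed_subspace closed_subspace.subspace subspace_0 by blast

lemma dual_norm_upper: "u \<in> fsubspace W i \<Longrightarrow> norm (R u) \<le> dual_norm i * norm u"
  by (rule onorm_on_upper) (rule norm_inv_frame_op_le')

lemma dual_norm_le: "i \<in> I \<Longrightarrow> dual_norm i \<le> 1 / A"
  by (rule onorm_on_le) (use norm_inv_frame_op_le' fsubspace_0 A_pos in simp_all)

lemma dual_norm_nonneg: "i \<in> I \<Longrightarrow> 0 \<le> dual_norm i"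
  by (rule onorm_on_nonneg, rule norm_inv_frame_op_le', rule fsubspace_0)

text \<open>By \<open>dual_proj_eq\<close> each dual projection of \<open>x\<close> is dominated by
  \<open>P i (R x)\<close>, so the dual sum is at most a multiple of the squared norm of
  \<open>T (R x)\<close>.\<close>

lemma bessel_canonical_dual: "bessel_fusion_sequence I (canonical_dual I W)"
proof -
  have seq: "fusion_sequence I (canonical_dual I W)"
    unfolding fusion_sequence_def
  proof
    fix i assume i: "i \<in> I"
    interpret D: closed_subspace "R ` fsubspace W i" using i by (rule closed_subspace_dual)
    have R0: "R 0 = 0" using norm_inv_frame_op_le[of 0] by simp
    have w: "0 \<le> fweight W i" "fsubspace W i = {0} \<longleftrightarrow> fweight W i = 0"
      using frame i by (auto simp: fusion_frame_def fusion_sequence_def)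
    have "R ` fsubspace W i = {0} \<longleftrightarrow> fweight W i * dual_norm i = 0"
    \<comment> \<open>For a nonzero subspace, injectivity of \<open>R\<close> makes both the image
      and \<open>dual_norm i\<close> nonzero.\<close>
    proof (cases "fsubspace W i = {0}")
      case False
      then obtain u where u: "u \<in> fsubspace W i" "u \<noteq> 0" using fsubspace_0[OF i] by blast
      have "R u \<noteq> 0" using frame_op_inv[of u] norm_frame_op_le[of 0] u(2)
        by (metis mult_zero_right norm_le_zero_iff norm_zero)
      moreover from this have "dual_norm i \<noteq> 0" using dual_norm_upper[OF u(1)] by auto
      ultimately show ?thesis using u w False by auto
    qed (use w R0 in auto)
    then show "subspace (fsubspace (canonical_dual I W) i) \<and> closed (fsubspace (canonical_dual I W) i) \<and>
        0 \<le> fweight (canonical_dual I W) i \<and>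
        (fsubspace (canonical_dual I W) i = {0} \<longleftrightarrow> fweight (canonical_dual I W) i = 0)"
      using D.subspace D.closed w(1) dual_norm_nonneg[OF i] by (simp add: canonical_dual_def)
  qed
  \<comment> \<open>The factor \<open>1 / A\<close> bounds \<open>dual_norm i\<close> and the factor
    \<open>B\<close> bounds the dual projection after \<open>S\<close>.\<close>
  define k where "k = (B / A)\<^sup>2"
  have k: "0 < k" using A_pos B_pos by (simp add: k_def)
  have le: "(fweight W i * dual_norm i)\<^sup>2 * (norm (dual_proj i x))\<^sup>2
      \<le> k * ((fweight W i)\<^sup>2 * (norm (P i (R x)))\<^sup>2)" if i: "i \<in> I" for i x
  proof -
    have "norm (dual_proj i x) \<le> B * norm (P i (R x))"
      by (subst dual_proj_eq[OF i]) (rule norm_dual_proj_le[OF i])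
    then have "dual_norm i * norm (dual_proj i x) \<le> 1 / A * (B * norm (P i (R x)))"
      using dual_norm_le[OF i] A_pos by (intro mult_mono) auto
    then have "(dual_norm i * norm (dual_proj i x))\<^sup>2 \<le> (1 / A * (B * norm (P i (R x))))\<^sup>2"
      using dual_norm_nonneg[OF i] by (intro power_mono) auto
    then have "(fweight W i)\<^sup>2 * (dual_norm i * norm (dual_proj i x))\<^sup>2
        \<le> (fweight W i)\<^sup>2 * (1 / A * (B * norm (P i (R x))))\<^sup>2" by (intro mult_left_mono) auto
    then show ?thesis by (simp add: k_def power_mult_distrib power_divide mult_ac)
  qed
  have sum: "(\<lambda>i. (fweight W i * dual_norm i)\<^sup>2 * (norm (dual_proj i x))\<^sup>2) summable_on I" for x
    by (rule summable_on_comparison_test[OF summable_on_cmult_right[OF analysis_op_summable] le])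
      auto
  have bound: "(\<Sum>\<^sub>\<infinity>i\<in>I. (fweight W i * dual_norm i)\<^sup>2 * (norm (dual_proj i x))\<^sup>2)
      \<le> k / A * (norm x)\<^sup>2" for x
  proof -
    have "(\<Sum>\<^sub>\<infinity>i\<in>I. (fweight W i * dual_norm i)\<^sup>2 * (norm (dual_proj i x))\<^sup>2)
        \<le> (\<Sum>\<^sub>\<infinity>i\<in>I. k * ((fweight W i)\<^sup>2 * (norm (P i (R x)))\<^sup>2))"
      by (intro infsum_mono sum summable_on_cmult_right analysis_op_summable le)
    also have "\<dots> = k * (norm (T (R x)))\<^sup>2"
      unfolding norm_analysis_op_sq by (rule infsum_cmult_right')
    also have "\<dots> \<le> k * (norm x / sqrt A)\<^sup>2"
      using k by (intro mult_left_mono power_mono norm_analysis_op_inv_le) auto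
    also have "\<dots> = k / A * (norm x)\<^sup>2" using A_pos by (simp add: power_divide)
    finally show ?thesis .
  qed
  have "k / A > 0" using k A_pos by simp
  then show ?thesis
    unfolding bessel_fusion_sequence_def using seq sum bound
    by (intro conjI exI[of _ "k / A"]) (simp_all add: canonical_dual_def)
qed

end

section \<open>Perturbations\<close>

text \<open>The bounds \<open>A'\<close> and \<open>B'\<close> of \<open>V\<close> stay abstract
  here. The inequality \<open>B \<le> B'\<close> lets \<open>B'\<close> bound both frame
  operators.\<close>

locale frame_pair = W: frame I W A B + V: frame I V A' B'
  for I :: "nat set" and W V :: "'a::{real_inner, complete_space} fusion_seq"
    and A B A' B' :: real +
  fixes \<mu> \<tau> :: real
  assumes analysis_op_diff: "norm (W.T x - V.T x) \<le> \<mu> * norm x"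
    and \<mu>: "0 \<le> \<mu>" and \<tau>: "0 < \<tau>"
    and W_weight: "i \<in> I \<Longrightarrow> \<tau> \<le> fweight W i"
    and V_weight: "i \<in> I \<Longrightarrow> \<tau> \<le> fweight V i"
    and B_le: "B \<le> B'"
begin

text \<open>Bounds the difference of the two frame operators in operator norm.\<close>

definition \<sigma> where "\<sigma> = \<mu> * (sqrt B + sqrt B')"
text \<open>Bounds \<open>R P - R' P'\<close> uniformly over the indices:
  \<open>\<mu> / \<tau>\<close> comes from the projections, \<open>\<sigma> / A'\<close> from the
  inverses.\<close>

definition \<kappa> where "\<kappa> = (\<mu> / \<tau> + \<sigma> / A') / A"

lemma \<sigma>_nonneg: "0 \<le> \<sigma>"
  using \<mu> W.B_pos V.B_pos by (simp add: \<sigma>_def)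

lemma \<kappa>_nonneg: "0 \<le> \<kappa>"
  using \<mu> \<tau> \<sigma>_nonneg W.A_pos V.A_pos by (simp add: \<kappa>_def)

text \<open>Tested against \<open>y\<close>, the difference is that of
  \<open>T x \<bullet> T y\<close> and its counterpart for \<open>V\<close>, changed one factor at a
  time.\<close>

lemma frame_op_diff: "norm (W.S x - V.S x) \<le> \<sigma> * norm x"
proof (rule norm_le_of_inner)
  fix y
  have "(W.S x - V.S x) \<bullet> y = (W.T x - V.T x) \<bullet> W.T y + V.T x \<bullet> (W.T y - V.T y)"
    by (simp add: inner_diff_left inner_diff_right W.inner_frame_op V.inner_frame_op)
  also have "\<dots> \<le> norm (W.T x - V.T x) * norm (W.T y) + norm (V.T x) * norm (W.T y - V.T y)"
    by (intro add_mono norm_cauchy_schwarz)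
  also have "\<dots> \<le> (\<mu> * norm x) * (sqrt B * norm y) + (sqrt B' * norm x) * (\<mu> * norm y)"
    using \<mu> W.B_pos V.B_pos
    by (intro add_mono mult_mono analysis_op_diff W.norm_analysis_op_le V.norm_analysis_op_le) auto
  also have "\<dots> = \<sigma> * norm x * norm y" by (simp add: \<sigma>_def algebra_simps)
  finally show "(W.S x - V.S x) \<bullet> y \<le> \<sigma> * norm x * norm y" .
qed (use \<sigma>_nonneg in simp)

text \<open>Resolvent identity: \<open>R - R' = R (S' - S) R'\<close>.\<close>

lemma inv_frame_op_diff: "norm (W.R x - V.R x) \<le> \<sigma> / (A * A') * norm x"
proof -
  have "W.R x - V.R x = W.R (V.S (V.R x) - W.S (V.R x))"
    by (simp add: linear_diff[OF bounded_linear.linear[OF W.inv_frame_op_bounded_linear]])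
  then have "norm (W.R x - V.R x) \<le> norm (W.S (V.R x) - V.S (V.R x)) / A"
    using W.norm_inv_frame_op_le by (metis norm_minus_commute)
  also have "\<dots> \<le> (\<sigma> * norm (V.R x)) / A"
    using W.A_pos by (intro divide_right_mono frame_op_diff) simp
  also have "\<dots> \<le> (\<sigma> * (norm x / A')) / A"
    using W.A_pos \<sigma>_nonneg by (intro divide_right_mono mult_left_mono V.norm_inv_frame_op_le) auto
  finally show ?thesis by (simp add: mult.commute)
qed

lemma weighted_proj_diff:
  assumes "i \<in> I"
  shows "norm (fweight W i *\<^sub>R W.P i x - fweight V i *\<^sub>R V.P i x) \<le> \<mu> * norm x"
  using norm_ell2_nth_le[of "W.T x - V.T x" i] analysis_op_diff[of x] assms
  by (simp add: minus_ell2.rep_eq W.analysis_op_nth V.analysis_op_nth)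

text \<open>Dividing the weighted difference by \<open>w \<ge> \<tau>\<close> exhibits a point of
  \<open>N\<close> close to \<open>m\<close>. The statement is kept abstract in \<open>M\<close> and
  \<open>N\<close> so that it serves both directions of the gap.\<close>

lemma distance_le_of_weighted_proj_diff:
  fixes w v :: real and M N :: "'a set"
  assumes "closed_subspace M" "closed_subspace N" "\<tau> \<le> w" "m \<in> M"
    and "norm (w *\<^sub>R orth_proj M m - v *\<^sub>R orth_proj N m) \<le> \<mu> * norm m"
  shows "norm (m - orth_proj N m) \<le> \<mu> / \<tau> * norm m"
proof -
  interpret M: closed_subspace M by fact
  interpret N: closed_subspace N by fact
  have w: "0 < w" using assms \<tau> by simp
  have "norm (m - orth_proj N m) \<le> norm (m - (v / w) *\<^sub>R orth_proj N m)"
    by (intro N.orth_proj_best subspace_scale N.subspace N.orth_proj_in)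
  also have "m - (v / w) *\<^sub>R orth_proj N m = (1 / w) *\<^sub>R (w *\<^sub>R orth_proj M m - v *\<^sub>R orth_proj N m)"
    using w M.orth_proj_id[OF assms(4)] by (simp add: scaleR_diff_right)
  also have "norm \<dots> \<le> 1 / w * (\<mu> * norm m)"
    unfolding norm_scaleR using w assms(5) by (intro mult_mono) auto
  also have "\<dots> \<le> 1 / \<tau> * (\<mu> * norm m)"
    using assms(3) \<tau> w \<mu> by (intro mult_right_mono divide_left_mono) auto
  finally show ?thesis by simp
qed

lemma proj_diff:
  assumes i: "i \<in> I"
  shows "norm (W.P i x - V.P i x) \<le> \<mu> / \<tau> * norm x"
proof (rule orth_proj_gap[OF W.closed_subspace[OF i] V.closed_subspace[OF i]])
  show "norm (m - V.P i m) \<le> \<mu> / \<tau> * norm m" if "m \<in> fsubspace W i" for m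
    by (rule distance_le_of_weighted_proj_diff[OF W.closed_subspace[OF i] V.closed_subspace[OF i] W_weight[OF i] that
          weighted_proj_diff[OF i]])
  show "norm (m - W.P i m) \<le> \<mu> / \<tau> * norm m" if "m \<in> fsubspace V i" for m
    by (rule distance_le_of_weighted_proj_diff[OF V.closed_subspace[OF i] W.closed_subspace[OF i] V_weight[OF i] that,
          where v = "fweight W i"])
      (subst norm_minus_commute, rule weighted_proj_diff[OF i])
qed (use \<mu> \<tau> in simp)

text \<open>Split as \<open>R (P - P') + (R - R') P'\<close>.\<close>

lemma inv_frame_op_proj_diff:
  assumes i: "i \<in> I"
  shows "norm (W.R (W.P i x) - V.R (V.P i x)) \<le> \<kappa> * norm x"
proof -
  have "W.R (W.P i x) - V.R (V.P i x)
      = W.R (W.P i x - V.P i x) + (W.R (V.P i x) - V.R (V.P i x))"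
    by (simp add: linear_diff[OF bounded_linear.linear[OF W.inv_frame_op_bounded_linear]])
  also have "norm \<dots> \<le> norm (W.R (W.P i x - V.P i x)) + norm (W.R (V.P i x) - V.R (V.P i x))"
    by (rule norm_triangle_ineq)
  also have "\<dots> \<le> (\<mu> / \<tau> * norm x) / A + \<sigma> / (A * A') * norm x"
  proof (rule add_mono)
    show "norm (W.R (W.P i x - V.P i x)) \<le> (\<mu> / \<tau> * norm x) / A"
      using W.A_pos
      by (intro order_trans[OF W.norm_inv_frame_op_le] divide_right_mono proj_diff i) simp
    show "norm (W.R (V.P i x) - V.R (V.P i x)) \<le> \<sigma> / (A * A') * norm x"
      using W.A_pos V.A_pos \<sigma>_nonneg closed_subspace.norm_orth_proj_le[OF V.closed_subspace[OF i]]
      by (intro order_trans[OF inv_frame_op_diff] mult_left_mono) auto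
  qed
  also have "\<dots> = \<kappa> * norm x"
    using W.A_pos V.A_pos \<tau> by (simp add: \<kappa>_def field_simps)
  finally show ?thesis .
qed

text \<open>For \<open>x\<close> in one subspace, compare the image of \<open>x\<close> with that of
  its projection onto the other subspace, which is no longer than \<open>x\<close>; then exchange
  the roles.\<close>

lemma dual_norm_diff:
  assumes i: "i \<in> I"
  shows "\<bar>W.dual_norm i - V.dual_norm i\<bar> \<le> \<kappa>"
proof -
  interpret Wi: closed_subspace "fsubspace W i" using i by (rule W.closed_subspace)
  interpret Vi: closed_subspace "fsubspace V i" using i by (rule V.closed_subspace)
  have "W.dual_norm i \<le> V.dual_norm i + \<kappa>"
  proof (rule onorm_on_le)
    fix x assume x: "x \<in> fsubspace W i"
    have "norm (W.R x) \<le> norm (V.R (V.P i x)) + norm (W.R x - V.R (V.P i x))"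
      by (rule norm_triangle_sub)
    also have "norm (V.R (V.P i x)) \<le> V.dual_norm i * norm (V.P i x)"
      by (rule V.dual_norm_upper[OF Vi.orth_proj_in])
    also have "\<dots> \<le> V.dual_norm i * norm x"
      by (intro mult_left_mono Vi.norm_orth_proj_le V.dual_norm_nonneg i)
    also have "norm (W.R x - V.R (V.P i x)) \<le> \<kappa> * norm x"
      using inv_frame_op_proj_diff[OF i, of x] Wi.orth_proj_id[OF x] by simp
    finally show "norm (W.R x) \<le> (V.dual_norm i + \<kappa>) * norm x" by (simp add: distrib_right)
  qed (use W.fsubspace_0[OF i] V.dual_norm_nonneg[OF i] \<kappa>_nonneg in auto)
  moreover have "V.dual_norm i \<le> W.dual_norm i + \<kappa>"
  proof (rule onorm_on_le)
    fix x assume x: "x \<in> fsubspace V i"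
    have "norm (V.R x) \<le> norm (W.R (W.P i x)) + norm (W.R (W.P i x) - V.R x)"
      using norm_triangle_sub[of "V.R x" "W.R (W.P i x)"] by (simp add: norm_minus_commute)
    also have "norm (W.R (W.P i x)) \<le> W.dual_norm i * norm (W.P i x)"
      by (rule W.dual_norm_upper[OF Wi.orth_proj_in])
    also have "\<dots> \<le> W.dual_norm i * norm x"
      by (intro mult_left_mono Wi.norm_orth_proj_le W.dual_norm_nonneg i)
    also have "norm (W.R (W.P i x) - V.R x) \<le> \<kappa> * norm x"
      using inv_frame_op_proj_diff[OF i, of x] Vi.orth_proj_id[OF x] by simp
    finally show "norm (V.R x) \<le> (W.dual_norm i + \<kappa>) * norm x" by (simp add: distrib_right)
  qed (use V.fsubspace_0[OF i] W.dual_norm_nonneg[OF i] \<kappa>_nonneg in auto)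
  ultimately show ?thesis by linarith
qed

text \<open>For \<open>m = R u\<close> with \<open>u\<close> in \<open>W_i\<close>, the point
  \<open>R' P' u\<close> of the other dual subspace is within \<open>\<kappa> * norm u\<close>, and
  \<open>u = S m\<close> is at most \<open>B' * norm m\<close> long. The other direction is
  analogous.\<close>

lemma dual_proj_diff:
  assumes i: "i \<in> I"
  shows "norm (W.dual_proj i x - V.dual_proj i x) \<le> B' * \<kappa> * norm x"
proof (rule orth_proj_gap[OF W.closed_subspace_dual[OF i] V.closed_subspace_dual[OF i]])
  interpret Wi: closed_subspace "fsubspace W i" using i by (rule W.closed_subspace)
  interpret Vi: closed_subspace "fsubspace V i" using i by (rule V.closed_subspace)
  interpret WD: closed_subspace "W.R ` fsubspace W i" using i by (rule W.closed_subspace_dual)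
  interpret VD: closed_subspace "V.R ` fsubspace V i" using i by (rule V.closed_subspace_dual)
  show "norm (m - V.dual_proj i m) \<le> B' * \<kappa> * norm m" if m: "m \<in> W.R ` fsubspace W i" for m
  proof -
    obtain u where u: "u \<in> fsubspace W i" "m = W.R u" using m by blast
    have "norm (m - V.dual_proj i m) \<le> norm (m - V.R (V.P i u))"
      by (intro VD.orth_proj_best imageI Vi.orth_proj_in)
    also have "\<dots> \<le> \<kappa> * norm u"
      using inv_frame_op_proj_diff[OF i, of u] Wi.orth_proj_id[OF u(1)] u(2) by simp
    also have "\<dots> \<le> \<kappa> * (B' * norm m)"
      using W.norm_frame_op_le[of m] u(2) mult_right_mono[OF B_le norm_ge_zero, of m]
      by (intro mult_left_mono \<kappa>_nonneg) simp
    finally show ?thesis by (simp add: mult_ac)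
  qed
  show "norm (m - W.dual_proj i m) \<le> B' * \<kappa> * norm m" if m: "m \<in> V.R ` fsubspace V i" for m
  proof -
    obtain u where u: "u \<in> fsubspace V i" "m = V.R u" using m by blast
    have "norm (m - W.dual_proj i m) \<le> norm (m - W.R (W.P i u))"
      by (intro WD.orth_proj_best imageI Wi.orth_proj_in)
    also have "\<dots> \<le> \<kappa> * norm u"
      using inv_frame_op_proj_diff[OF i, of u] Vi.orth_proj_id[OF u(1)] u(2)
      by (simp add: norm_minus_commute)
    also have "\<dots> \<le> \<kappa> * (B' * norm m)"
      using V.norm_frame_op_le[of m] u(2) by (intro mult_left_mono \<kappa>_nonneg) simp
    finally show ?thesis by (simp add: mult_ac)
  qed
qed (use V.B_pos \<kappa>_nonneg in simp)

text \<open>Three successive changes, of the norm, the projection and the frame operator; each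
  contributes one summand of the bound.\<close>

lemma scaled_dual_proj_diff:
  assumes i: "i \<in> I"
  shows "norm (W.dual_norm i *\<^sub>R W.dual_proj i (W.S y) - V.dual_norm i *\<^sub>R V.dual_proj i (V.S y))
    \<le> (\<kappa> * B' + B'\<^sup>2 * \<kappa> / A + \<sigma> / A) * norm y"
proof -
  interpret WD: closed_subspace "W.R ` fsubspace W i" using i by (rule W.closed_subspace_dual)
  let ?g = "W.dual_norm i" and ?h = "V.dual_norm i"
  have g: "0 \<le> ?g" "?g \<le> 1 / A" using i W.dual_norm_nonneg W.dual_norm_le by auto
  have eq: "?g *\<^sub>R W.dual_proj i (W.S y) - ?h *\<^sub>R V.dual_proj i (V.S y)
      = (?g - ?h) *\<^sub>R V.dual_proj i (V.S y)
        + ?g *\<^sub>R (W.dual_proj i (V.S y) - V.dual_proj i (V.S y))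
        + ?g *\<^sub>R W.dual_proj i (W.S y - V.S y)"
    by (simp add: WD.orth_proj_diff algebra_simps)
  have "norm (?g *\<^sub>R W.dual_proj i (W.S y) - ?h *\<^sub>R V.dual_proj i (V.S y))
      \<le> norm ((?g - ?h) *\<^sub>R V.dual_proj i (V.S y))
      + norm (?g *\<^sub>R (W.dual_proj i (V.S y) - V.dual_proj i (V.S y)))
      + norm (?g *\<^sub>R W.dual_proj i (W.S y - V.S y))"
    unfolding eq by (rule order_trans[OF norm_triangle_ineq add_right_mono[OF norm_triangle_ineq]])
  also have "\<dots> \<le> \<kappa> * (B' * norm y) + 1 / A * (B' * \<kappa> * (B' * norm y)) + 1 / A * (\<sigma> * norm y)"
  proof (rule add_mono[OF add_mono])
    show "norm ((?g - ?h) *\<^sub>R V.dual_proj i (V.S y)) \<le> \<kappa> * (B' * norm y)"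
      unfolding norm_scaleR
      by (rule mult_mono[OF dual_norm_diff[OF i] V.norm_dual_proj_le[OF i] \<kappa>_nonneg norm_ge_zero])
    have "norm (W.dual_proj i (V.S y) - V.dual_proj i (V.S y)) \<le> B' * \<kappa> * norm (V.S y)"
      by (rule dual_proj_diff[OF i])
    also have "\<dots> \<le> B' * \<kappa> * (B' * norm y)"
      using V.B_pos \<kappa>_nonneg by (simp add: mult_left_mono V.norm_frame_op_le)
    finally show "norm (?g *\<^sub>R (W.dual_proj i (V.S y) - V.dual_proj i (V.S y)))
        \<le> 1 / A * (B' * \<kappa> * (B' * norm y))"
      using mult_mono[OF g(2)] g W.A_pos by simp
    have "norm (W.dual_proj i (W.S y - V.S y)) \<le> \<sigma> * norm y"
      using WD.norm_orth_proj_le frame_op_diff by (rule order_trans)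
    then show "norm (?g *\<^sub>R W.dual_proj i (W.S y - V.S y)) \<le> 1 / A * (\<sigma> * norm y)"
      using mult_mono[OF g(2)] g W.A_pos by simp
  qed
  also have "\<dots> = (\<kappa> * B' + B'\<^sup>2 * \<kappa> / A + \<sigma> / A) * norm y"
    by (simp add: power2_eq_square algebra_simps)
  finally show ?thesis .
qed

text \<open>Split as \<open>(T - T') R' + T (R - R')\<close>.\<close>

lemma analysis_op_inv_diff:
  "norm (W.T (W.R x) - V.T (V.R x)) \<le> (\<mu> / A' + sqrt B * (\<sigma> / (A * A'))) * norm x"
proof -
  have "W.T (W.R x) - V.T (V.R x) = (W.T (V.R x) - V.T (V.R x)) + W.T (W.R x - V.R x)"
    by (simp add: linear_diff[OF bounded_linear.linear[OF W.analysis_op_bounded_linear]])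
  also have "norm \<dots> \<le> norm (W.T (V.R x) - V.T (V.R x)) + norm (W.T (W.R x - V.R x))"
    by (rule norm_triangle_ineq)
  also have "\<dots> \<le> \<mu> * (norm x / A') + sqrt B * (\<sigma> / (A * A') * norm x)"
  proof (rule add_mono)
    show "norm (W.T (V.R x) - V.T (V.R x)) \<le> \<mu> * (norm x / A')"
      using \<mu> by (intro order_trans[OF analysis_op_diff] mult_left_mono V.norm_inv_frame_op_le)
    show "norm (W.T (W.R x - V.R x)) \<le> sqrt B * (\<sigma> / (A * A') * norm x)"
      using W.B_pos
      by (intro order_trans[OF W.norm_analysis_op_le] mult_left_mono inv_frame_op_diff) simp
  qed
  also have "\<dots> = (\<mu> / A' + sqrt B * (\<sigma> / (A * A'))) * norm x" by (simp add: algebra_simps)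
  finally show ?thesis .
qed

text \<open>Here \<open>B' / A'\<close> bounds the factor in front of \<open>T R - T' R'\<close>,
  the bracket over \<open>sqrt A\<close> comes from \<open>scaled_dual_proj_diff\<close>, and
  \<open>1 / sqrt A\<close> bounds \<open>T R\<close>.\<close>

lemma canonical_dual_analysis_op_diff:
  "norm (analysis_op I (canonical_dual I W) x - analysis_op I (canonical_dual I V) x)
    \<le> (B' / A' * (\<mu> / A' + sqrt B * (\<sigma> / (A * A')))
        + (\<kappa> * B' + B'\<^sup>2 * \<kappa> / A + \<sigma> / A) / sqrt A) * norm x"
proof -
  interpret DW: bessel_fusion I "canonical_dual I W"
    by unfold_locales (rule W.bessel_canonical_dual)
  interpret DV: bessel_fusion I "canonical_dual I V"
    by unfold_locales (rule V.bessel_canonical_dual)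
  let ?X = "\<lambda>i y. W.dual_norm i *\<^sub>R W.dual_proj i (W.S y) - V.dual_norm i *\<^sub>R V.dual_proj i (V.S y)"
  let ?Y = "\<lambda>i y. V.dual_norm i *\<^sub>R V.dual_proj i (V.S y)"
  define u where "u = W.T (W.R x) - V.T (V.R x)"
  define v where "v = W.T (W.R x)"
  define g where "g i = (if i \<in> I then ?Y i (ell2_nth u i) else 0)" for i
  define h where "h i = (if i \<in> I then ?X i (ell2_nth v i) else 0)" for i
  define l where "l = \<kappa> * B' + B'\<^sup>2 * \<kappa> / A + \<sigma> / A"
  have l: "0 \<le> l"
    unfolding l_def using \<kappa>_nonneg \<sigma>_nonneg V.B_pos W.A_pos by auto
  have k: "0 \<le> B' / A'" using V.B_pos V.A_pos by simp
  have "norm (DW.T x - DV.T x) \<le> B' / A' * norm u + l * norm v"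
  proof (rule norm_ell2_mono2[where g = g and h = h])
    fix i
    show "norm (g i) \<le> B' / A' * norm (ell2_nth u i)"
    proof (cases "i \<in> I")
      case True
      have "norm (g i) = V.dual_norm i * norm (V.dual_proj i (V.S (ell2_nth u i)))"
        using True V.dual_norm_nonneg[OF True] by (simp add: g_def)
      also have "\<dots> \<le> 1 / A' * (B' * norm (ell2_nth u i))"
        using V.A_pos True
        by (intro mult_mono V.dual_norm_le V.norm_dual_proj_le) auto
      finally show ?thesis by simp
    qed (use V.B_pos V.A_pos in \<open>simp add: g_def\<close>)
    show "norm (h i) \<le> l * norm (ell2_nth v i)"
      unfolding h_def l_def using scaled_dual_proj_diff l[unfolded l_def] by simp
    show "ell2_nth (DW.T x - DV.T x) i = g i + h i"
    proof (cases "i \<in> I")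
      case True
      interpret WD: closed_subspace "W.R ` fsubspace W i" using True by (rule W.closed_subspace_dual)
      interpret VD: closed_subspace "V.R ` fsubspace V i" using True by (rule V.closed_subspace_dual)
      have lin: "linear (\<lambda>y. W.dual_proj i (W.S y))" "linear (\<lambda>y. V.dual_proj i (V.S y))"
        by (intro bounded_linear.linear bounded_linear_compose[OF WD.orth_proj_bounded_linear]
            bounded_linear_compose[OF VD.orth_proj_bounded_linear]
            W.frame_op_bounded_linear V.frame_op_bounded_linear)+
      have "ell2_nth (DW.T x - DV.T x) i
          = (fweight W i * W.dual_norm i) *\<^sub>R W.dual_proj i x
            - (fweight V i * V.dual_norm i) *\<^sub>R V.dual_proj i x"
        using True
        by (simp add: minus_ell2.rep_eq DW.analysis_op_nth DV.analysis_op_nth)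
          (simp add: canonical_dual_def)
      \<comment> \<open>After \<open>dual_proj_eq\<close> the weights move inside the linear maps,
        where they turn the projections into components of \<open>T (R x)\<close> and its
        counterpart for \<open>V\<close>. In \<open>g i + h i\<close> the mixed term
        cancels.\<close>
      also have "\<dots> = W.dual_norm i *\<^sub>R W.dual_proj i (W.S (fweight W i *\<^sub>R W.P i (W.R x)))
          - V.dual_norm i *\<^sub>R V.dual_proj i (V.S (fweight V i *\<^sub>R V.P i (V.R x)))"
        unfolding linear_scale[OF lin(1)] linear_scale[OF lin(2)]
          W.dual_proj_eq[OF True, symmetric] V.dual_proj_eq[OF True, symmetric]
        by (simp add: mult.commute)
      also have "\<dots> = g i + h i"
        using True
        by (simp add: g_def h_def u_def v_def minus_ell2.rep_eq W.analysis_op_nth V.analysis_op_nth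
            linear_diff[OF lin(2)] scaleR_diff_right)
      finally show ?thesis .
    qed (simp add: g_def h_def minus_ell2.rep_eq DW.analysis_op_nth DV.analysis_op_nth)
  qed (use k l in auto)
  also have "\<dots> \<le> B' / A' * ((\<mu> / A' + sqrt B * (\<sigma> / (A * A'))) * norm x) + l * (norm x / sqrt A)"
    unfolding u_def v_def using k l
    by (intro add_mono mult_left_mono analysis_op_inv_diff W.norm_analysis_op_inv_le)
  also have "\<dots> = (B' / A' * (\<mu> / A' + sqrt B * (\<sigma> / (A * A'))) + l / sqrt A) * norm x"
    by (simp add: distrib_right)
  finally show ?thesis unfolding l_def .
qed

end

section \<open>The numerical estimate of the constant\<close>

text \<open>The left side is the preceding bound with \<open>A = \<alpha>\<close>,
  \<open>B = \<beta>\<close>, \<open>1 / A' = d\<^sup>2\<close> and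
  \<open>\<sigma> = \<mu> * c\<close>. Its first summand is absorbed by the last term of the
  bracket, and the quotient by \<open>sqrt \<alpha>\<close> by the first term.\<close>

lemma dual_perturbation_constant_bound:
  fixes \<alpha> \<beta> \<mu> \<tau> c d B' :: real
  assumes \<alpha>: "0 < \<alpha>" "\<alpha> \<le> \<beta>" and \<mu>: "0 < \<mu>" "\<mu> < sqrt \<alpha>" and \<tau>: "0 < \<tau>"
    and c: "c = 2 * sqrt \<beta> + \<mu>" and d: "d = inverse (sqrt \<alpha> - \<mu>)"
    and B': "B' = (sqrt \<beta> + \<mu>)\<^sup>2"
  shows "B' * d\<^sup>2 * (\<mu> * d\<^sup>2 + sqrt \<beta> * (\<mu> * c * d\<^sup>2 / \<alpha>))
      + ((\<mu> / \<tau> + \<mu> * c * d\<^sup>2) / \<alpha> * B' + B'\<^sup>2 * ((\<mu> / \<tau> + \<mu> * c * d\<^sup>2) / \<alpha>) / \<alpha>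
          + \<mu> * c / \<alpha>) / sqrt \<alpha>
    \<le> (c\<^sup>2 + d\<^sup>2) / \<alpha> *
        ((1 + (inverse \<alpha> + \<beta>)\<^sup>2) / sqrt \<alpha> * (sqrt 2 / \<tau> + c * d\<^sup>2) + d\<^sup>2 * (1 + c\<^sup>2 * d\<^sup>2)) * \<mu>"
proof -
  define Q where "Q = 1 + (inverse \<alpha> + \<beta>)\<^sup>2"
  define \<eta> where "\<eta> = sqrt 2 / \<tau> + c * d\<^sup>2"
  \<comment> \<open>Chosen so that \<open>\<kappa>\<close> becomes
    \<open>\<mu> * \<eta>' / \<alpha>\<close>.\<close>
  define \<eta>' where "\<eta>' = 1 / \<tau> + c * d\<^sup>2"
  have \<beta>: "0 < \<beta>" using \<alpha> by simp
  have sqrt_le: "sqrt \<alpha> \<le> sqrt \<beta>" using \<alpha> by simp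
  have c_pos: "0 < c" using c \<beta> \<mu> by (simp add: add_pos_pos)
  have d_pos: "0 < d" using d \<mu> by simp
  have B'_nonneg: "0 \<le> B'" by (simp add: B')
  \<comment> \<open>Uses \<open>\<mu> < sqrt \<alpha> \<le> sqrt \<beta>\<close>.\<close>
  have B'_le: "B' \<le> 4 * \<beta>"
  proof -
    have "B' \<le> (2 * sqrt \<beta>)\<^sup>2" unfolding B' using \<mu> sqrt_le \<beta> by (intro power_mono) linarith+
    then show ?thesis using \<beta> by (simp add: power_mult_distrib)
  qed
  have c_sq: "4 * \<beta> \<le> c\<^sup>2"
  proof -
    have "(2 * sqrt \<beta>)\<^sup>2 \<le> c\<^sup>2" unfolding c using \<mu> \<beta> by (intro power_mono) auto
    then show ?thesis using \<beta> by (simp add: power_mult_distrib)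
  qed
  have d_sq: "inverse \<alpha> \<le> d\<^sup>2"
  proof -
    have "(sqrt \<alpha> - \<mu>)\<^sup>2 \<le> (sqrt \<alpha>)\<^sup>2" using \<mu> by (intro power_mono) auto
    then have "inverse ((sqrt \<alpha>)\<^sup>2) \<le> inverse ((sqrt \<alpha> - \<mu>)\<^sup>2)"
      using \<mu> by (intro le_imp_inverse_le) auto
    then show ?thesis using \<alpha> by (simp add: d power_inverse)
  qed
  have \<eta>'_le: "\<eta>' \<le> \<eta>" using \<tau> by (simp add: \<eta>_def \<eta>'_def divide_right_mono)
  have \<eta>'_nonneg: "0 \<le> \<eta>'" using \<tau> c_pos by (simp add: \<eta>'_def)
  have cd_le: "c * d\<^sup>2 \<le> \<eta>" using \<tau> by (simp add: \<eta>_def)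
  have Q_nonneg: "0 \<le> Q" by (simp add: Q_def)

  have t1: "B' * d\<^sup>2 * (\<mu> * d\<^sup>2 + sqrt \<beta> * (\<mu> * c * d\<^sup>2 / \<alpha>))
      \<le> \<mu> * ((c\<^sup>2 + d\<^sup>2) / \<alpha> * (d\<^sup>2 * (1 + c\<^sup>2 * d\<^sup>2)))"
  proof -
    \<comment> \<open>Two uses of \<open>c \<ge> 2 * sqrt \<beta>\<close> leave room for
      \<open>2 * \<beta>\<close>, which exceeds \<open>\<alpha>\<close>.\<close>
    have "c * (2 * sqrt \<beta>) \<le> c * c" using c_pos \<mu> by (intro mult_left_mono) (auto simp: c)
    moreover have "2 * sqrt \<beta> * sqrt \<beta> \<le> c * sqrt \<beta>" using \<beta> \<mu> by (intro mult_right_mono) (auto simp: c)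
    moreover have "sqrt \<beta> * sqrt \<beta> = \<beta>" using \<beta> by simp
    ultimately have "sqrt \<beta> * c + 2 * \<beta> \<le> c * c" by argo
    then have e: "\<alpha> + sqrt \<beta> * c \<le> c\<^sup>2"
      using \<alpha> \<beta> by (simp add: power2_eq_square)
    have "B' * d\<^sup>2 * (\<mu> * d\<^sup>2 + sqrt \<beta> * (\<mu> * c * d\<^sup>2 / \<alpha>))
        = \<mu> * d\<^sup>2 * d\<^sup>2 / \<alpha> * (B' * (\<alpha> + sqrt \<beta> * c))"
      using \<alpha> by (simp add: field_simps)
    also have "\<dots> \<le> \<mu> * d\<^sup>2 * d\<^sup>2 / \<alpha> * (c\<^sup>2 * c\<^sup>2)"
      using e \<mu> \<alpha> \<beta> B'_le c_sq c_pos by (intro mult_left_mono mult_mono) auto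
    also have "\<dots> = \<mu> * (c\<^sup>2 / \<alpha> * (d\<^sup>2 * (c\<^sup>2 * d\<^sup>2)))" by (simp add: power2_eq_square mult_ac)
    also have "\<dots> \<le> \<mu> * ((c\<^sup>2 + d\<^sup>2) / \<alpha> * (d\<^sup>2 * (1 + c\<^sup>2 * d\<^sup>2)))"
      using \<mu> \<alpha> by (intro mult_left_mono mult_mono divide_right_mono) auto
    finally show ?thesis .
  qed

  have t2: "B' + B'\<^sup>2 / \<alpha> \<le> c\<^sup>2 * Q"
  proof -
    have "B'\<^sup>2 / \<alpha> = B' * (B' / \<alpha>)" by (simp add: power2_eq_square)
    also have "\<dots> \<le> c\<^sup>2 * (4 * \<beta> / \<alpha>)"
      using B'_le c_sq B'_nonneg \<alpha> by (intro mult_mono divide_right_mono) auto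
    also have "\<dots> \<le> c\<^sup>2 * (inverse \<alpha> + \<beta>)\<^sup>2"
    proof (intro mult_left_mono)
      \<comment> \<open>The inequality of arithmetic and geometric means for
        \<open>inverse \<alpha>\<close> and \<open>\<beta>\<close>; it accounts for
        \<open>Q\<close>.\<close>
      have "0 \<le> (inverse \<alpha> - \<beta>)\<^sup>2" by simp
      also have "\<dots> = (inverse \<alpha> + \<beta>)\<^sup>2 - 4 * \<beta> / \<alpha>"
        by (simp add: power2_eq_square divide_inverse algebra_simps)
      finally show "4 * \<beta> / \<alpha> \<le> (inverse \<alpha> + \<beta>)\<^sup>2" by simp
    qed simp
    finally show ?thesis using B'_le c_sq by (simp add: Q_def distrib_left)
  qed

  \<comment> \<open>The summand \<open>\<mu> * c / \<alpha>\<close> has no factor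
    \<open>\<eta>'\<close>; it is charged to the share \<open>d\<^sup>2\<close> of
    \<open>c\<^sup>2 + d\<^sup>2\<close>, while \<open>t2\<close> uses the share
    \<open>c\<^sup>2\<close>.\<close>
  have t3: "c \<le> d\<^sup>2 * Q * (c * d\<^sup>2)"
  proof -
    have "1 \<le> (inverse \<alpha> * \<beta>)\<^sup>2" using \<alpha> by (intro one_le_power) (simp add: field_simps)
    also have "\<dots> = inverse \<alpha> * inverse \<alpha> * \<beta>\<^sup>2" by (simp add: power2_eq_square)
    also have "\<dots> \<le> d\<^sup>2 * d\<^sup>2 * Q"
    proof (intro mult_mono d_sq)
      have "\<beta>\<^sup>2 \<le> (inverse \<alpha> + \<beta>)\<^sup>2" using \<alpha> \<beta> by (intro power_mono) auto
      then show "\<beta>\<^sup>2 \<le> Q" by (simp add: Q_def)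
    qed (use \<alpha> in auto)
    finally have "c * 1 \<le> c * (d\<^sup>2 * d\<^sup>2 * Q)" using c_pos by (intro mult_left_mono) auto
    then show ?thesis by (simp add: mult_ac)
  qed

  have "(\<mu> / \<tau> + \<mu> * c * d\<^sup>2) / \<alpha> * B' + B'\<^sup>2 * ((\<mu> / \<tau> + \<mu> * c * d\<^sup>2) / \<alpha>) / \<alpha> + \<mu> * c / \<alpha>
      = \<mu> / \<alpha> * (\<eta>' * (B' + B'\<^sup>2 / \<alpha>) + c)"
    using \<alpha> \<tau> by (simp add: \<eta>'_def algebra_simps add_divide_distrib)
  also have "\<dots> \<le> \<mu> / \<alpha> * (\<eta> * (c\<^sup>2 * Q) + d\<^sup>2 * Q * \<eta>)"
  proof (intro mult_left_mono add_mono)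
    show "\<eta>' * (B' + B'\<^sup>2 / \<alpha>) \<le> \<eta> * (c\<^sup>2 * Q)"
      using \<eta>'_le \<eta>'_nonneg t2 B'_nonneg \<alpha> by (intro mult_mono) auto
    have "d\<^sup>2 * Q * (c * d\<^sup>2) \<le> d\<^sup>2 * Q * \<eta>"
      using cd_le Q_nonneg by (intro mult_left_mono) auto
    then show "c \<le> d\<^sup>2 * Q * \<eta>" using t3 by simp
  qed (use \<mu> \<alpha> in auto)
  also have "\<dots> = \<mu> * ((c\<^sup>2 + d\<^sup>2) / \<alpha> * (Q * \<eta>))"
    by (simp add: algebra_simps add_divide_distrib)
  finally have "((\<mu> / \<tau> + \<mu> * c * d\<^sup>2) / \<alpha> * B' + B'\<^sup>2 * ((\<mu> / \<tau> + \<mu> * c * d\<^sup>2) / \<alpha>) / \<alpha>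
      + \<mu> * c / \<alpha>) / sqrt \<alpha> \<le> \<mu> * ((c\<^sup>2 + d\<^sup>2) / \<alpha> * (Q * \<eta>)) / sqrt \<alpha>"
    using \<alpha> by (intro divide_right_mono) auto
  with t1 have "B' * d\<^sup>2 * (\<mu> * d\<^sup>2 + sqrt \<beta> * (\<mu> * c * d\<^sup>2 / \<alpha>))
      + ((\<mu> / \<tau> + \<mu> * c * d\<^sup>2) / \<alpha> * B' + B'\<^sup>2 * ((\<mu> / \<tau> + \<mu> * c * d\<^sup>2) / \<alpha>) / \<alpha>
          + \<mu> * c / \<alpha>) / sqrt \<alpha>
    \<le> \<mu> * ((c\<^sup>2 + d\<^sup>2) / \<alpha> * (d\<^sup>2 * (1 + c\<^sup>2 * d\<^sup>2))) + \<mu> * ((c\<^sup>2 + d\<^sup>2) / \<alpha> * (Q * \<eta>)) / sqrt \<alpha>"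
    by (rule add_mono)
  also have "\<dots> = (c\<^sup>2 + d\<^sup>2) / \<alpha> * (Q / sqrt \<alpha> * \<eta> + d\<^sup>2 * (1 + c\<^sup>2 * d\<^sup>2)) * \<mu>"
    using distrib_left[of "\<mu> * ((c\<^sup>2 + d\<^sup>2) / \<alpha>)" "Q / sqrt \<alpha> * \<eta>" "d\<^sup>2 * (1 + c\<^sup>2 * d\<^sup>2)"]
    by (simp add: mult_ac)
  finally show ?thesis unfolding Q_def \<eta>_def .
qed

section \<open>Frame bounds of the perturbed sequence and conclusion\<close>

text \<open>Frame bounds are squares of lower and upper bounds of the analysis operator, and the
  triangle inequality shifts the latter by at most \<open>\<mu>\<close>.\<close>

lemma fusion_frame_perturbation:
  fixes W V :: "'a::{real_inner, complete_space} fusion_seq"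
  assumes W: "fusion_frame I W \<alpha> \<beta>" and V: "bessel_fusion_sequence I V"
    and \<mu>: "0 \<le> \<mu>" "\<mu> < sqrt \<alpha>"
    and diff: "\<And>x. norm (analysis_op I W x - analysis_op I V x) \<le> \<mu> * norm x"
  shows "fusion_frame I V ((sqrt \<alpha> - \<mu>)\<^sup>2) ((sqrt \<beta> + \<mu>)\<^sup>2)"
proof -
  interpret W: frame I W \<alpha> \<beta> by (unfold_locales) (rule W)
  interpret V: bessel_fusion I V by (unfold_locales) (rule V)
  have \<alpha>\<beta>: "\<alpha> \<le> \<beta>" using W by (simp add: fusion_frame_def)
  have le: "(norm (V.T x))\<^sup>2 \<le> (sqrt \<beta> + \<mu>)\<^sup>2 * (norm x)\<^sup>2" for x
  proof -
    have "norm (V.T x) \<le> norm (W.T x) + norm (W.T x - V.T x)"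
      using norm_triangle_sub[of "V.T x" "W.T x"] by (simp add: norm_minus_commute)
    then have "norm (V.T x) \<le> (sqrt \<beta> + \<mu>) * norm x"
      using diff[of x] W.norm_analysis_op_le[of x] by (simp add: distrib_right)
    from power_mono[OF this norm_ge_zero, of 2] show ?thesis by (simp add: power_mult_distrib)
  qed
  have ge: "(sqrt \<alpha> - \<mu>)\<^sup>2 * (norm x)\<^sup>2 \<le> (norm (V.T x))\<^sup>2" for x
  proof -
    have "(sqrt \<alpha> - \<mu>) * norm x \<le> norm (V.T x)"
      using diff[of x] W.norm_analysis_op_ge[of x] norm_triangle_sub[of "W.T x" "V.T x"]
      by (simp add: left_diff_distrib)
    \<comment> \<open>Squaring is legitimate because \<open>\<mu> < sqrt \<alpha>\<close> makes the
      left side nonnegative.\<close>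
    from power_mono[OF this, of 2] show ?thesis using \<mu> by (simp add: power_mult_distrib)
  qed
  have "(sqrt \<alpha> - \<mu>)\<^sup>2 \<le> (sqrt \<beta> + \<mu>)\<^sup>2"
    using \<mu> real_sqrt_le_mono[OF \<alpha>\<beta>] by (intro power_mono) linarith+
  moreover have "0 < (sqrt \<beta> + \<mu>)\<^sup>2" using W.B_pos \<mu> by (intro zero_less_power add_pos_nonneg) auto
  ultimately show ?thesis
    using V V.analysis_op_summable le ge \<mu>
    by (auto simp: fusion_frame_def bessel_fusion_sequence_def V.norm_analysis_op_sq)
qed

theorem theorem5p6:
  fixes I :: "nat set"
    and W V :: "'a::{real_inner, complete_space} fusion_seq"
    and \<alpha> \<beta> \<mu> \<tau> c d C :: real
  assumes "fusion_frame I W \<alpha> \<beta>"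
    and "0 < \<mu>" and "\<mu> < sqrt \<alpha>"
    and "fusion_perturbation I \<mu> V W"
    and "0 < \<tau>"
    and "\<forall>i\<in>I. \<tau> \<le> fweight W i"
    and "\<forall>i\<in>I. \<tau> \<le> fweight V i"
    and "c = 2 * sqrt \<beta> + \<mu>"
    and "d = inverse (sqrt \<alpha> - \<mu>)"
    and "C = (c\<^sup>2 + d\<^sup>2) / \<alpha> *
             ((1 + (inverse \<alpha> + \<beta>)\<^sup>2) / sqrt \<alpha> * (sqrt 2 / \<tau> + c * d\<^sup>2)
              + d\<^sup>2 * (1 + c\<^sup>2 * d\<^sup>2))"
  shows "fusion_perturbation I (C * \<mu>) (canonical_dual I V) (canonical_dual I W)"
proof -
  interpret Wf: frame I W \<alpha> \<beta> by (unfold_locales) (rule assms(1))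
  have \<alpha>\<beta>: "\<alpha> \<le> \<beta>" using assms(1) by (simp add: fusion_frame_def)
  have V: "bessel_fusion_sequence I V" using assms(4) by (simp add: fusion_perturbation_def)
  interpret Vb: bessel_fusion I V by (unfold_locales) (rule V)
  have diff: "norm (Wf.T x - Vb.T x) \<le> \<mu> * norm x" for x
  proof -
    \<comment> \<open>Bounded linearity turns the operator norm bound into a pointwise one.\<close>
    have "bounded_linear (\<lambda>x. Wf.T x - Vb.T x)"
      by (intro bounded_linear_sub Wf.analysis_op_bounded_linear Vb.analysis_op_bounded_linear)
    from onorm[OF this] have "norm (Wf.T x - Vb.T x) \<le> onorm (\<lambda>x. Wf.T x - Vb.T x) * norm x" .
    also have "\<dots> \<le> \<mu> * norm x"
      using assms(4) by (intro mult_right_mono) (simp_all add: fusion_perturbation_def)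
    finally show ?thesis .
  qed
  interpret frame_pair I W V \<alpha> \<beta> "(sqrt \<alpha> - \<mu>)\<^sup>2" "(sqrt \<beta> + \<mu>)\<^sup>2" \<mu> \<tau>
  proof unfold_locales
    show "fusion_frame I V ((sqrt \<alpha> - \<mu>)\<^sup>2) ((sqrt \<beta> + \<mu>)\<^sup>2)"
      using assms(2) by (intro fusion_frame_perturbation[OF assms(1) V _ assms(3) diff]) simp
    have "(sqrt \<beta>)\<^sup>2 \<le> (sqrt \<beta> + \<mu>)\<^sup>2"
      using assms(2) Wf.B_pos by (intro power_mono) auto
    then show "\<beta> \<le> (sqrt \<beta> + \<mu>)\<^sup>2" using Wf.B_pos by simp
  qed (use assms diff in auto)
  let ?B' = "(sqrt \<beta> + \<mu>)\<^sup>2"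
  \<comment> \<open>Divisions by the lower frame bound of \<open>V\<close> become factors
    \<open>d\<^sup>2\<close>.\<close>
  have inv: "1 / (sqrt \<alpha> - \<mu>)\<^sup>2 = d\<^sup>2" using assms(9) by (simp add: power_inverse inverse_eq_divide power_divide)
  then have inv': "r / (sqrt \<alpha> - \<mu>)\<^sup>2 = r * d\<^sup>2" for r by (metis divide_inverse inverse_eq_divide)
  have inv'': "r / (\<alpha> * (sqrt \<alpha> - \<mu>)\<^sup>2) = r * d\<^sup>2 / \<alpha>" for r
    by (metis inv' divide_divide_eq_left' divide_divide_eq_left)
  \<comment> \<open>The origin of \<open>c\<close>: the square roots of the two upper frame bounds
    add up to \<open>2 * sqrt \<beta> + \<mu>\<close>.\<close>
  have \<sigma>: "\<sigma> = \<mu> * c"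
    unfolding \<sigma>_def assms(8) using Wf.B_pos assms(2) by simp
  have c_pos: "0 < c" using Wf.B_pos assms(2) by (simp add: assms(8) add_pos_pos)
  \<comment> \<open>The definition of a perturbation requires \<open>C * \<mu>\<close> to be
    positive.\<close>
  have "0 < C"
  proof -
    have "0 < (c\<^sup>2 + d\<^sup>2) / \<alpha>" using c_pos Wf.A_pos by (simp add: add_pos_nonneg)
    moreover have "0 < (1 + (inverse \<alpha> + \<beta>)\<^sup>2) / sqrt \<alpha> * (sqrt 2 / \<tau> + c * d\<^sup>2)"
      using c_pos Wf.A_pos assms(5) by (intro mult_pos_pos divide_pos_pos add_pos_nonneg) auto
    ultimately show ?thesis
      unfolding assms(10) by (rule mult_pos_pos[OF _ add_pos_nonneg]) simp
  qed
  then have C\<mu>: "0 < C * \<mu>" using assms(2) by simp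
  have "norm (analysis_op I (canonical_dual I W) x - analysis_op I (canonical_dual I V) x)
      \<le> C * \<mu> * norm x" for x
  proof (rule order_trans[OF canonical_dual_analysis_op_diff mult_right_mono])
    show "?B' / (sqrt \<alpha> - \<mu>)\<^sup>2 * (\<mu> / (sqrt \<alpha> - \<mu>)\<^sup>2 + sqrt \<beta> * (\<sigma> / (\<alpha> * (sqrt \<alpha> - \<mu>)\<^sup>2)))
        + (\<kappa> * ?B' + ?B'\<^sup>2 * \<kappa> / \<alpha> + \<sigma> / \<alpha>) / sqrt \<alpha> \<le> C * \<mu>"
      unfolding \<kappa>_def inv' inv'' \<sigma> assms(10)
      by (rule dual_perturbation_constant_bound[OF Wf.A_pos \<alpha>\<beta> assms(2,3,5,8,9) refl])
  qed simp
  then have "onorm (\<lambda>x. analysis_op I (canonical_dual I W) x - analysis_op I (canonical_dual I V) x)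
      \<le> C * \<mu>"
    using C\<mu> by (intro onorm_bound) auto
  then show ?thesis
    unfolding fusion_perturbation_def
    using C\<mu> Wf.bessel_canonical_dual V.bessel_canonical_dual by blast
qed

end
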